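(* Let $f$ be a (non-constant) proper holomorphic function from a domain $\Omega\subset\hat{\mathbb{C}}$ to $\mathbb{D}$ such that $\infty\in\Omega$ and $f(\infty)=0$, and let $m(\infty)$ be the multiplicity of the zero of $f$ at $\infty$. For every $t\in(0,1)$ let \[ \Omega_t:=\{z\in\Omega:|f(z)|<t\},\qquad K_t:=\hat{\mathbb{C}}\setminus\Omega_t . \] Then the function \[ F(t):=t^{\frac{1}{m(\infty)}}\cdot\mathrm{cap}(K_t),\qquad t\in(0,1), \] is non-decreasing, and there exists $t_1\in(0,1)$ such that \[ F(t)=|f^{(m(\infty))}(\infty)|^{\frac{1}{m(\infty)}},\qquad t\in(0,t_1), \] where $f^{(m(\infty))}(\infty):=\lim_{z\to\infty}z^{m(\infty)}f(z)$.
   Context: $\mathbb{D}=\{z\in\mathbb{C}:|z|<1\}$ and $\hat{\mathbb{C}}$ is the extended complex plane. A map $F:X\to Y$ between topological spaces is proper if $F^{-1}(K)$ is compact for every compact $K\subset Y$. The logarithmic capacity of a compact set $E\subset\mathbb{C}$ is $\mathrm{cap}(E)=e^{-I(E)}$, where $I(E)=\inf_\mu\iint\log\frac{1}{|z-w|}\,d\mu(z)\,d\mu(w)$, the infimum being over all Borel probability measures $\mu$ supported on $E$. *)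

theory Defs
  imports "HOL-Complex_Analysis.Complex_Analysis" "HOL-Probability.Probability"
begin

section \<open>The Riemann sphere\<close>

text \<open>The extended plane is the one-point compactification of the complex plane:
  \<open>None\<close> is the point at infinity and \<open>Some z\<close> is the finite point \<open>z\<close>.\<close>

definition riemann_sphere :: "complex option topology" where
  "riemann_sphere = Alexandroff_compactification euclidean"

definition sphere_domain :: "complex option set \<Rightarrow> bool" where
  "sphere_domain \<Omega> \<longleftrightarrow>
     \<Omega> \<noteq> {} \<and> openin riemann_sphere \<Omega> \<and> connectedin riemann_sphere \<Omega>"

text \<open>The coordinate \<open>w = 1 / z\<close> around infinity.\<close>

definition infinity_chart :: "complex \<Rightarrow> complex option" where
  "infinity_chart w = (if w = 0 then None else Some (inverse w))"

definition sphere_holomorphic_on :: "(complex option \<Rightarrow> complex) \<Rightarrow> complex option set \<Rightarrow> bool"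
  where
  "sphere_holomorphic_on f \<Omega> \<longleftrightarrow>
     (f \<circ> Some) holomorphic_on (Some -` \<Omega>) \<and>
     (f \<circ> infinity_chart) holomorphic_on (infinity_chart -` \<Omega>)"

text \<open>The library constant \<^const>\<open>zorder\<close> is integer-valued; it is non-negative at a zero of a
  non-constant holomorphic function.\<close>

definition zero_multiplicity_infinity :: "(complex option \<Rightarrow> complex) \<Rightarrow> nat" where
  "zero_multiplicity_infinity f = nat (zorder (f \<circ> infinity_chart) 0)"

text \<open>This is the number written \<open>f\<^sup>(\<^sup>m\<^sup>)(\<infinity>)\<close> with \<open>m\<close> the multiplicity at infinity. It is the first
  non-zero Taylor coefficient in the coordinate \<open>1 / z\<close>, without any factor \<open>m!\<close>.\<close>

definition leading_coeff_infinity :: "(complex option \<Rightarrow> complex) \<Rightarrow> complex" where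
  "leading_coeff_infinity f =
     Lim at_infinity (\<lambda>z. z ^ zero_multiplicity_infinity f * f (Some z))"


section \<open>Proper maps\<close>

text \<open>The library's \<^const>\<open>proper_map\<close> asks for a closed map with compact fibres; for continuous maps
  into a locally compact Hausdorff space this is the condition on preimages of compact sets used
  here, see the lemma below.\<close>

definition compact_preimage_map :: "'a topology \<Rightarrow> 'b topology \<Rightarrow> ('a \<Rightarrow> 'b) \<Rightarrow> bool" where
  "compact_preimage_map X Y f \<longleftrightarrow>
     f \<in> topspace X \<rightarrow> topspace Y \<and>
     (\<forall>K. compactin Y K \<longrightarrow> compactin X {x \<in> topspace X. f x \<in> K})"

lemma compact_preimage_map_iff_proper_map:
  assumes "locally_compact_space Y" "Hausdorff_space Y" "continuous_map X Y f"
  shows "compact_preimage_map X Y f \<longleftrightarrow> proper_map X Y f"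
  using assms
  by (simp add: compact_preimage_map_def proper_eq_compact_map
      locally_compact_imp_k_space Hausdorff_imp_kc_space)


section \<open>Logarithmic capacity\<close>

text \<open>The Lebesgue integral of an extended-real function as the difference of the integrals of its
  positive and negative parts; \<^const>\<open>e2ennreal\<close> sends negative values to \<open>0\<close>.\<close>

definition ereal_integral :: "'a measure \<Rightarrow> ('a \<Rightarrow> ereal) \<Rightarrow> ereal" where
  "ereal_integral M f =
     enn2ereal (\<integral>\<^sup>+ x. e2ennreal (f x) \<partial>M) - enn2ereal (\<integral>\<^sup>+ x. e2ennreal (- f x) \<partial>M)"

text \<open>The value on the diagonal has to be given explicitly, because \<open>ln (1 / 0)\<close> is \<open>0\<close> in HOL.\<close>

definition log_kernel :: "complex \<Rightarrow> complex \<Rightarrow> ereal" where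
  "log_kernel z w = (if z = w then \<infinity> else ereal (ln (1 / cmod (z - w))))"

definition log_energy :: "complex measure \<Rightarrow> ereal" where
  "log_energy \<mu> = ereal_integral (\<mu> \<Otimes>\<^sub>M \<mu>) (\<lambda>(z, w). log_kernel z w)"

text \<open>For closed \<open>E\<close>, being supported on \<open>E\<close> means that the complement of \<open>E\<close> is a null set.\<close>

definition borel_prob_measures_on :: "complex set \<Rightarrow> complex measure set" where
  "borel_prob_measures_on E =
     {\<mu>. prob_space \<mu> \<and> sets \<mu> = sets borel \<and> (AE z in \<mu>. z \<in> E)}"

definition robin_constant :: "complex set \<Rightarrow> ereal" where
  "robin_constant E = (INF \<mu> \<in> borel_prob_measures_on E. log_energy \<mu>)"

text \<open>The case distinction implements \<open>exp (- \<infinity>) = 0\<close>. The value \<open>- \<infinity>\<close> of the infimum does not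
  occur for compact \<open>E\<close>, as the kernel is then bounded below on \<open>E \<times> E\<close>.\<close>

definition log_capacity :: "complex set \<Rightarrow> real" where
  "log_capacity E =
     (if robin_constant E = \<infinity> then 0 else exp (- real_of_ereal (robin_constant E)))"


section \<open>Sublevel sets\<close>

definition sublevel :: "(complex option \<Rightarrow> complex) \<Rightarrow> complex option set \<Rightarrow> real \<Rightarrow> complex option set"
  where
  "sublevel f \<Omega> t = {z \<in> \<Omega>. cmod (f z) < t}"

text \<open>The complement of the sublevel set, as a set of finite points: when \<open>f\<close> vanishes at
  infinity and \<open>t > 0\<close>, the complement does not contain the point at infinity.\<close>

definition sublevel_complement :: "(complex option \<Rightarrow> complex) \<Rightarrow> complex option set \<Rightarrow> real \<Rightarrow> complex set"
  where
  "sublevel_complement f \<Omega> t = Some -` (topspace riemann_sphere - sublevel f \<Omega> t)"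

definition normalized_capacity :: "(complex option \<Rightarrow> complex) \<Rightarrow> complex option set \<Rightarrow> real \<Rightarrow> real"
  where
  "normalized_capacity f \<Omega> t =
     t powr (1 / real (zero_multiplicity_infinity f)) * log_capacity (sublevel_complement f \<Omega> t)"

end

theory Submission
  imports Defs "HOL-Real_Asymp.Real_Asymp"
begin

text \<open>
  The logarithmic capacity is accessible through monic polynomials. On the one hand, a monic
  polynomial \<open>p\<close> of degree \<open>n\<close> with \<open>\<bar>p\<bar> \<le> M\<close> on \<open>K\<close> forces \<open>cap K \<le> M\<^bsup>1/n\<^esup>\<close>: Lagrange
  interpolation bounds the Vandermonde products of points of \<open>K\<close>, and these bounds integrate to
  lower bounds for energies. On the other hand, nearly maximal Vandermonde products (Fekete sets)
  provide polynomials whose sup norms are controlled by the product, and smearing out the Fekete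
  points over small annuli gives measures of nearly the same energy on any neighbourhood of \<open>K\<close>.
  No equilibrium measure is needed.

  Write \<open>m\<close> for the multiplicity at infinity, \<open>c\<close> for the leading coefficient, and let \<open>p\<close> be monic of
  degree \<open>n\<close> with \<open>\<bar>p\<bar> \<le> M\<close> on \<open>K\<^sub>t\<close>. The function \<open>p\<^sup>m f\<^sup>n\<close> is holomorphic on \<open>\<Omega>\<^sub>t\<close>, with value \<open>c\<^sup>n\<close>
  at infinity, and bounded by \<open>M\<^sup>m t\<^sup>n\<close> on the boundary. The maximum principle therefore gives
  \<open>\<bar>p\<bar> \<le> M (t/s)\<^bsup>n/m\<^esup>\<close> on \<open>K\<^sub>s\<close> for \<open>s < t\<close>, hence the monotonicity, and \<open>\<bar>c\<bar>\<^sup>n \<le> M\<^sup>m t\<^sup>n\<close>, hence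
  \<open>F(t) \<ge> \<bar>c\<bar>\<^bsup>1/m\<^esup>\<close>. For small \<open>t\<close> the reverse inequality is witnessed by polynomials whose zeros are
  equally spaced on a small circle in a coordinate \<open>\<zeta>\<close> at infinity with \<open>f = \<zeta>\<^sup>m\<close>.
\<close>

section \<open>Vandermonde products\<close>

text \<open>The product runs over ordered pairs, so it is the squared modulus of the Vandermonde
  determinant of the points of \<open>A\<close>.\<close>

definition pair_product :: "complex set \<Rightarrow> real" where
  "pair_product A = (\<Prod>a\<in>A. \<Prod>b\<in>A - {a}. cmod (a - b))"

lemma pair_product_pos: "finite A \<Longrightarrow> 0 < pair_product A"
  unfolding pair_product_def by (intro prod_pos) auto

lemma pair_product_insert:
  assumes "finite B" "w \<notin> B"
  shows "pair_product (insert w B) = pair_product B * (\<Prod>b\<in>B. cmod (w - b))\<^sup>2"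
proof -
  have "(\<Prod>b\<in>insert w B - {a}. cmod (a - b)) = cmod (w - a) * (\<Prod>b\<in>B - {a}. cmod (a - b))"
    if "a \<in> B" for a
  proof -
    have "insert w B - {a} = insert w (B - {a})"
      using that assms by auto
    then show ?thesis
      using assms by (simp add: norm_minus_commute)
  qed
  moreover have "insert w B - {w} = B"
    using assms by auto
  ultimately show ?thesis
    using assms by (simp add: pair_product_def prod.distrib power2_eq_square)
qed

text \<open>Compare the top coefficients in the Lagrange interpolation formula with deg p + 1 nodes:
  the basis polynomial at \<open>a\<close> has leading coefficient 1 / \<Prod>(a - b).\<close>

lemma lagrange_lead_coeff:
  fixes p :: "'a::field poly"
  assumes "finite A" "card A = Suc (degree p)"
  shows "(\<Sum>a\<in>A. poly p a / (\<Prod>b\<in>A - {a}. a - b)) = lead_coeff p"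
proof -
  define L where "L a = smult (poly p a / (\<Prod>b\<in>A - {a}. a - b)) (\<Prod>b\<in>A - {a}. [:- b, 1:])" for a
  have deg_prod: "degree (\<Prod>b\<in>A - {a}. [:- b, 1:]) = degree p"
    and lead_prod: "coeff (\<Prod>b\<in>A - {a}. [:- b, 1:]) (degree p) = 1" if "a \<in> A" for a
  proof -
    show *: "degree (\<Prod>b\<in>A - {a}. [:- b, 1:]) = degree p"
      using assms that by (subst degree_prod_eq_sum_degree) auto
    have "lead_coeff (\<Prod>b\<in>A - {a}. [:- b, 1:]) = 1"
      by (simp add: lead_coeff_prod)
    then show "coeff (\<Prod>b\<in>A - {a}. [:- b, 1:]) (degree p) = 1"
      by (simp add: *)
  qed
  have "p = (\<Sum>a\<in>A. L a)"
  proof (rule poly_eqI_degree)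
    fix x assume x: "x \<in> A"
    have "poly (L a) x = (if a = x then poly p x else 0)" if "a \<in> A" for a
      using that x assms(1)
      by (auto simp: L_def poly_prod prod_zero_iff)
    then show "poly p x = poly (\<Sum>a\<in>A. L a) x"
      using x assms(1) by (simp add: poly_sum sum.delta)
  next
    show "degree p < card A"
      using assms by simp
    have "degree (L a) \<le> degree p" if "a \<in> A" for a
      using deg_prod[OF that] by (auto simp: L_def intro: order_trans[OF degree_smult_le])
    then have "degree (\<Sum>a\<in>A. L a) \<le> degree p"
      by (intro degree_sum_le) (use assms in auto)
    then show "degree (\<Sum>a\<in>A. L a) < card A"
      using assms by simp
  qed
  then have "lead_coeff p = (\<Sum>a\<in>A. coeff (L a) (degree p))"
    by (metis coeff_sum)
  also have "\<dots> = (\<Sum>a\<in>A. poly p a / (\<Prod>b\<in>A - {a}. a - b))"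
    by (intro sum.cong) (auto simp: L_def lead_prod)
  finally show ?thesis ..
qed

text \<open>Points are removed one at a time. Interpolating a monic polynomial of degree
  \<open>n\<close> at the n + 1 remaining points finds a point whose distances to the others have
  product at most (n + 1) \<open>B n\<close>; deleting it divides the pair product by the square of
  that product.\<close>

lemma pair_product_le:
  fixes K :: "complex set" and B :: "nat \<Rightarrow> real"
  assumes B: "\<And>k. \<exists>p. lead_coeff p = 1 \<and> degree p = k \<and> (\<forall>z\<in>K. cmod (poly p z) \<le> B k)"
  assumes "A \<subseteq> K" "finite A"
  shows "pair_product A \<le> (\<Prod>k<card A. real (Suc k) * B k)\<^sup>2"
  using assms(2,3)
proof (induction "card A" arbitrary: A)
  case 0
  then show ?case by (simp add: pair_product_def)
next
  case (Suc n)
  obtain p where p: "lead_coeff p = 1" "degree p = n" "\<forall>z\<in>K. cmod (poly p z) \<le> B n"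
    using B by blast
  define q where "q a = (\<Prod>b\<in>A - {a}. cmod (a - b))" for a
  have q_pos: "q a > 0" for a
    unfolding q_def by (intro prod_pos) auto
  have ne: "A \<noteq> {}"
    using Suc by auto
  have "1 = cmod (\<Sum>a\<in>A. poly p a / (\<Prod>b\<in>A - {a}. a - b))"
    using lagrange_lead_coeff[of A p] Suc p by simp
  also have "\<dots> \<le> (\<Sum>a\<in>A. cmod (poly p a / (\<Prod>b\<in>A - {a}. a - b)))"
    by (rule norm_sum)
  also have "\<dots> = (\<Sum>a\<in>A. cmod (poly p a) / q a)"
    by (simp add: q_def norm_divide prod_norm)
  also have "\<dots> \<le> (\<Sum>a\<in>A. B n / q a)"
    using p(3) Suc.prems q_pos by (intro sum_mono divide_right_mono) (auto intro: less_imp_le)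
  finally have "1 \<le> (\<Sum>a\<in>A. B n / q a)" .
  \<comment> \<open>If every \<open>q a\<close> were larger, each of the n + 1 summands would be
    below 1 / (n + 1) and the sum could not reach 1.\<close>
  have "\<exists>a\<in>A. q a \<le> real (Suc n) * B n"
  proof (rule ccontr)
    assume "\<not> ?thesis"
    then have "B n / q a < 1 / real (Suc n)" if "a \<in> A" for a
      using that q_pos[of a] by (auto simp: field_simps)
    then have "(\<Sum>a\<in>A. B n / q a) < (\<Sum>a\<in>A. 1 / real (Suc n))"
      using ne Suc.prems by (intro sum_strict_mono) auto
    also have "\<dots> = 1"
      using Suc.hyps(2)[symmetric] by simp
    finally show False
      using \<open>1 \<le> _\<close> by simp
  qed
  then obtain a where a: "a \<in> A" "q a \<le> real (Suc n) * B n" by blast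
  have card: "card (A - {a}) = n" "A - {a} \<subseteq> K" "finite (A - {a})"
    using a Suc by auto
  have "pair_product A = pair_product (insert a (A - {a}))"
    using a by (simp add: insert_absorb)
  also have "\<dots> = pair_product (A - {a}) * (q a)\<^sup>2"
    using card by (subst pair_product_insert) (auto simp: q_def)
  also have "\<dots> \<le> (\<Prod>k<n. real (Suc k) * B k)\<^sup>2 * (real (Suc n) * B n)\<^sup>2"
  proof (rule mult_mono)
    show "pair_product (A - {a}) \<le> (\<Prod>k<n. real (Suc k) * B k)\<^sup>2"
      using Suc.hyps(1)[of "A - {a}"] card by simp
    show "(q a)\<^sup>2 \<le> (real (Suc n) * B n)\<^sup>2"
      using a(2) q_pos[of a] by (intro power_mono) auto
  qed auto
  finally show ?case
    by (simp add: power_mult_distrib Suc.hyps(2)[symmetric])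
qed

text \<open>Take a set whose pair product exceeds a quarter of the supremum. Exchanging
  \<open>a\<close> for \<open>w\<close> multiplies the pair product by the squared ratio of the two
  products in the claim, and this factor is at most 4. Settling for a near maximum avoids asking
  whether the supremum is attained.\<close>

lemma ex_nearly_fekete_set:
  assumes "infinite K" "bounded K"
  obtains A where "A \<subseteq> K" "finite A" "card A = n"
    "\<And>a w. a \<in> A \<Longrightarrow> w \<in> K \<Longrightarrow>
       (\<Prod>b\<in>A - {a}. cmod (w - b)) \<le> 2 * (\<Prod>b\<in>A - {a}. cmod (a - b))"
proof -
  define \<F> where "\<F> = {A. A \<subseteq> K \<and> finite A \<and> card A = n}"
  define R where "R = max 1 (diameter K)"
  have R: "R \<ge> 1" "\<And>z w. z \<in> K \<Longrightarrow> w \<in> K \<Longrightarrow> cmod (z - w) \<le> R"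
    using diameter_bounded_bound[OF assms(2)] by (fastforce simp: R_def dist_norm)+
  have "pair_product A \<le> (R ^ n) ^ n" if A: "A \<in> \<F>" for A
  proof -
    have "(\<Prod>b\<in>A - {a}. cmod (a - b)) \<le> R ^ n" if "a \<in> A" for a
    proof -
      have "(\<Prod>b\<in>A - {a}. cmod (a - b)) \<le> (\<Prod>b\<in>A - {a}. R)"
        using A R that by (intro prod_mono) (auto simp: \<F>_def)
      also have "\<dots> \<le> R ^ n"
        using A R by (auto simp: \<F>_def intro!: power_increasing card_mono)
      finally show ?thesis .
    qed
    then have "pair_product A \<le> (\<Prod>a\<in>A. R ^ n)"
      unfolding pair_product_def by (intro prod_mono) (auto intro!: prod_nonneg)
    then show ?thesis
      using A by (simp add: \<F>_def)
  qed
  then have bdd: "bdd_above (pair_product ` \<F>)"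
    by (intro bdd_aboveI[where M = "(R ^ n) ^ n"]) auto
  obtain A0 where "A0 \<in> \<F>"
    using infinite_arbitrarily_large[OF assms(1)] by (auto simp: \<F>_def)
  define S where "S = (SUP A\<in>\<F>. pair_product A)"
  have "0 < S"
    using pair_product_pos[of A0] cSUP_upper[OF \<open>A0 \<in> \<F>\<close> bdd] \<open>A0 \<in> \<F>\<close>
    by (auto simp: S_def \<F>_def)
  \<comment> \<open>The 4 is the square of the factor 2 in the claim, since the pair product
    contains each distance twice.\<close>
  then have "S / 4 < S" by simp
  then obtain A where A: "A \<in> \<F>" "S / 4 < pair_product A"
    using less_cSUP_iff[OF _ bdd, of "S / 4"] \<open>A0 \<in> \<F>\<close> unfolding S_def by blast
  show ?thesis
  proof (rule that)
    show "A \<subseteq> K" "finite A" "card A = n"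
      using A by (auto simp: \<F>_def)
    fix a w assume a: "a \<in> A" and w: "w \<in> K"
    define q where "q x = (\<Prod>b\<in>A - {a}. cmod (x - b))" for x
    have "q w \<le> 2 * q a"
    proof (cases "w \<in> A - {a}")
      case True
      then have "q w = 0"
        using \<open>finite A\<close> by (auto simp: q_def)
      then show ?thesis
        by (simp add: q_def prod_nonneg)
    next
      case False
      have "insert w (A - {a}) \<in> \<F>"
        using \<open>A \<subseteq> K\<close> \<open>finite A\<close> \<open>card A = n\<close> a w False
        by (auto simp: \<F>_def card_insert_if card_Diff_singleton dest: card_gt_0_iff[THEN iffD2])
          (metis One_nat_def Suc_pred card_gt_0_iff empty_iff)+
      then have "pair_product (insert w (A - {a})) \<le> S"
        unfolding S_def by (intro cSUP_upper bdd)
      also have "\<dots> \<le> 4 * pair_product (insert a (A - {a}))"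
        using A a by (simp add: insert_absorb)
      finally have "pair_product (A - {a}) * (q w)\<^sup>2 \<le> pair_product (A - {a}) * (2 * q a)\<^sup>2"
        using False \<open>finite A\<close> by (subst (asm) (1 2) pair_product_insert) (auto simp: q_def)
      then have "(q w)\<^sup>2 \<le> (2 * q a)\<^sup>2"
        using pair_product_pos[of "A - {a}"] \<open>finite A\<close> by simp
      then show ?thesis
        by (rule power2_le_imp_le) (simp add: q_def prod_nonneg)
    qed
    then show "(\<Prod>b\<in>A - {a}. cmod (w - b)) \<le> 2 * (\<Prod>b\<in>A - {a}. cmod (a - b))"
      by (simp add: q_def)
  qed
qed

section \<open>Lower bounds for the logarithmic energy\<close>

lemma log_kernel_measurable [measurable]:
  "(\<lambda>(z, w). log_kernel z w) \<in> borel_measurable (borel \<Otimes>\<^sub>M borel)"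
  unfolding log_kernel_def case_prod_beta by measurable

lemma ereal_integral_eq_integral:
  assumes "integrable M g" "AE x in M. f x = ereal (g x)"
  shows "ereal_integral M f = ereal (\<integral>x. g x \<partial>M)"
proof -
  have "(\<integral>\<^sup>+ x. e2ennreal (f x) \<partial>M) = (\<integral>\<^sup>+ x. ennreal (g x) \<partial>M)"
    using assms(2) by (intro nn_integral_cong_AE) (auto elim!: eventually_mono simp: ennreal.abs_eq)
  moreover have "(\<integral>\<^sup>+ x. e2ennreal (- f x) \<partial>M) = (\<integral>\<^sup>+ x. ennreal (- g x) \<partial>M)"
    using assms(2) by (intro nn_integral_cong_AE) (auto elim!: eventually_mono simp: ennreal.abs_eq)
  moreover have "enn2ereal (\<integral>\<^sup>+ x. ennreal (g x) \<partial>M) = ereal (enn2real (\<integral>\<^sup>+ x. ennreal (g x) \<partial>M))"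
    "enn2ereal (\<integral>\<^sup>+ x. ennreal (- g x) \<partial>M) = ereal (enn2real (\<integral>\<^sup>+ x. ennreal (- g x) \<partial>M))"
    using assms(1)
    by (auto simp: real_integrable_def simp flip: enn2ereal_ennreal intro!: arg_cong[of _ _ enn2ereal]
        ennreal_enn2real[symmetric] simp: less_top)
  ultimately show ?thesis
    using real_lebesgue_integral_def[OF assms(1)] by (simp add: ereal_integral_def)
qed

text \<open>The lower bound on a finite measure space makes the negative part integrable, so only an
  infinite positive part could give the value \<infinity>.\<close>

lemma ereal_integral_finiteD:
  assumes "finite_measure M" and [measurable]: "f \<in> borel_measurable M"
    and lower: "AE x in M. - ereal C \<le> f x" and fin: "ereal_integral M f \<noteq> \<infinity>"
  shows "AE x in M. f x \<noteq> \<infinity>" "integrable M (\<lambda>x. real_of_ereal (f x))"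
proof -
  interpret finite_measure M by fact
  have "(\<integral>\<^sup>+ x. e2ennreal (- f x) \<partial>M) \<le> (\<integral>\<^sup>+ x. ennreal C \<partial>M)"
  proof (intro nn_integral_mono_AE eventually_mono[OF lower])
    fix x assume "- ereal C \<le> f x"
    then have "- f x \<le> ereal C"
      using ereal_minus_le_minus by fastforce
    then show "e2ennreal (- f x) \<le> ennreal C"
      by (metis e2ennreal_mono ennreal.abs_eq e2ennreal_ereal)
  qed
  also have "\<dots> < \<infinity>"
    by (simp add: ennreal_mult_eq_top_iff less_top[symmetric])
  finally have neg: "(\<integral>\<^sup>+ x. e2ennreal (- f x) \<partial>M) < \<infinity>" .
  have pos: "(\<integral>\<^sup>+ x. e2ennreal (f x) \<partial>M) < \<infinity>"
  proof (rule ccontr)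
    assume "\<not> ?thesis"
    then have "(\<integral>\<^sup>+ x. e2ennreal (f x) \<partial>M) = \<infinity>"
      by (auto simp: less_top[symmetric])
    with neg fin show False
      by (cases "\<integral>\<^sup>+ x. e2ennreal (- f x) \<partial>M") (auto simp: ereal_integral_def enn2ereal_ennreal)
  qed
  have "AE x in M. e2ennreal (f x) \<noteq> \<infinity>"
    using pos by (intro nn_integral_PInf_AE) auto
  then show ne: "AE x in M. f x \<noteq> \<infinity>"
    by (auto elim!: eventually_mono)
  show "integrable M (\<lambda>x. real_of_ereal (f x))"
  proof (rule integrableI_bounded)
    have "(\<integral>\<^sup>+ x. ennreal (norm (real_of_ereal (f x))) \<partial>M)
      \<le> (\<integral>\<^sup>+ x. e2ennreal (f x) + e2ennreal (- f x) \<partial>M)"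
    proof (rule nn_integral_mono)
      fix x
      show "ennreal (norm (real_of_ereal (f x))) \<le> e2ennreal (f x) + e2ennreal (- f x)"
      proof (cases "f x")
        case (real r)
        then show ?thesis
          by (cases "r \<ge> 0") (auto simp: e2ennreal_ereal ennreal_neg)
      qed auto
    qed
    also have "\<dots> < \<infinity>"
      using neg pos by (subst nn_integral_add) auto
    finally show "(\<integral>\<^sup>+ x. ennreal (norm (real_of_ereal (f x))) \<partial>M) < \<infinity>" .
  qed measurable
qed

text \<open>Both marginals of the product measure are carried by \<open>K\<close>, where distances
  are at most exp C; on the diagonal the kernel is \<infinity>.\<close>

lemma AE_log_kernel_ge:
  assumes \<mu>: "\<mu> \<in> borel_prob_measures_on K"
    and C: "\<And>z w. z \<in> K \<Longrightarrow> w \<in> K \<Longrightarrow> cmod (z - w) \<le> exp C"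
  shows "AE x in \<mu> \<Otimes>\<^sub>M \<mu>. - ereal C \<le> (\<lambda>(z, w). log_kernel z w) x"
proof -
  interpret \<mu>: prob_space \<mu>
    using \<mu> by (simp add: borel_prob_measures_on_def)
  interpret pair_prob_space \<mu> \<mu> ..
  have K: "AE z in \<mu>. z \<in> K"
    using \<mu> by (simp add: borel_prob_measures_on_def)
  have AE_fst: "AE x in \<mu> \<Otimes>\<^sub>M \<mu>. fst x \<in> K"
    by (rule AE_distrD[where M' = \<mu>, of fst]) (simp, unfold \<mu>.distr_pair_fst, rule K)
  have snd_eq: "distr (\<mu> \<Otimes>\<^sub>M \<mu>) \<mu> snd = \<mu>"
  proof (rule measure_eqI)
    fix A assume "A \<in> sets (distr (\<mu> \<Otimes>\<^sub>M \<mu>) \<mu> snd)"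
    then have A: "A \<in> sets \<mu>"
      by simp
    moreover have "snd -` A \<inter> space (\<mu> \<Otimes>\<^sub>M \<mu>) = space \<mu> \<times> A"
      using sets.sets_into_space[OF A] by (auto simp: space_pair_measure)
    ultimately show "emeasure (distr (\<mu> \<Otimes>\<^sub>M \<mu>) \<mu> snd) A = emeasure \<mu> A"
      by (simp add: emeasure_distr \<mu>.emeasure_pair_measure_Times \<mu>.emeasure_space_1)
  qed simp
  have "AE x in \<mu> \<Otimes>\<^sub>M \<mu>. snd x \<in> K"
    by (rule AE_distrD[where M' = \<mu>, of snd]) (simp, unfold snd_eq, rule K)
  then show ?thesis
    using AE_fst
  proof eventually_elim
    case (elim x)
    then show ?case
      using ln_mono[OF C[of "fst x" "snd x"]] by (auto simp: log_kernel_def case_prod_beta ln_div)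
  qed
qed

text \<open>The kernel is infinite on the diagonal, so an energy other than \<infinity> makes the
  diagonal a null set. Off it the kernel is real, and the energy becomes a Bochner integral.\<close>

lemma log_energy_finiteD:
  assumes \<mu>: "\<mu> \<in> borel_prob_measures_on K" and "bounded K" and fin: "log_energy \<mu> \<noteq> \<infinity>"
  shows "AE x in \<mu> \<Otimes>\<^sub>M \<mu>. fst x \<noteq> snd x"
    and "integrable (\<mu> \<Otimes>\<^sub>M \<mu>) (\<lambda>x. ln (1 / cmod (fst x - snd x)))"
    and "log_energy \<mu> = ereal (\<integral>x. ln (1 / cmod (fst x - snd x)) \<partial>(\<mu> \<Otimes>\<^sub>M \<mu>))"
proof -
  interpret \<mu>: prob_space \<mu>
    using \<mu> by (simp add: borel_prob_measures_on_def)
  interpret pair_prob_space \<mu> \<mu> ..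
  have sets_\<mu> [measurable_cong]: "sets \<mu> = sets borel"
    using \<mu> by (simp add: borel_prob_measures_on_def)
  define R where "R = max 1 (diameter K)"
  have R: "R \<ge> 1" "\<And>z w. z \<in> K \<Longrightarrow> w \<in> K \<Longrightarrow> cmod (z - w) \<le> R"
    using diameter_bounded_bound[OF assms(2)] by (fastforce simp: R_def dist_norm)+
  have meas: "(\<lambda>(z, w). log_kernel z w) \<in> borel_measurable (\<mu> \<Otimes>\<^sub>M \<mu>)"
    by measurable
  have lower: "AE x in \<mu> \<Otimes>\<^sub>M \<mu>. - ereal (ln R) \<le> (\<lambda>(z, w). log_kernel z w) x"
    using R by (intro AE_log_kernel_ge[OF \<mu>]) auto
  have fm: "finite_measure (\<mu> \<Otimes>\<^sub>M \<mu>)"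
    by unfold_locales
  note * = ereal_integral_finiteD[OF fm meas lower fin[unfolded log_energy_def]]
  show ne: "AE x in \<mu> \<Otimes>\<^sub>M \<mu>. fst x \<noteq> snd x"
    using *(1) by (auto elim!: eventually_mono simp: log_kernel_def)
  have "(\<lambda>x. real_of_ereal (case x of (z, w) \<Rightarrow> log_kernel z w)) = (\<lambda>x. ln (1 / cmod (fst x - snd x)))"
    by (auto simp: fun_eq_iff log_kernel_def)
  with *(2) show int: "integrable (\<mu> \<Otimes>\<^sub>M \<mu>) (\<lambda>x. ln (1 / cmod (fst x - snd x)))"
    by simp
  show "log_energy \<mu> = ereal (\<integral>x. ln (1 / cmod (fst x - snd x)) \<partial>(\<mu> \<Otimes>\<^sub>M \<mu>))"
    unfolding log_energy_def
    by (rule ereal_integral_eq_integral[OF int])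
       (use ne in \<open>auto elim!: eventually_mono simp: log_kernel_def\<close>)
qed

text \<open>Turns the expectation of a function of two coordinates of a random tuple into a double
  integral. The two measures agree on rectangles, which determine them.\<close>

lemma distr_PiM_pair:
  assumes "prob_space \<mu>" "finite I" "i \<in> I" "j \<in> I" "i \<noteq> j"
  shows "distr (PiM I (\<lambda>_. \<mu>)) (\<mu> \<Otimes>\<^sub>M \<mu>) (\<lambda>\<omega>. (\<omega> i, \<omega> j)) = \<mu> \<Otimes>\<^sub>M \<mu>"
proof -
  interpret \<mu>: prob_space \<mu> by fact
  interpret P: product_prob_space "\<lambda>_. \<mu>" I ..
  have [measurable]: "(\<lambda>\<omega>. \<omega> i) \<in> PiM I (\<lambda>_. \<mu>) \<rightarrow>\<^sub>M \<mu>" "(\<lambda>\<omega>. \<omega> j) \<in> PiM I (\<lambda>_. \<mu>) \<rightarrow>\<^sub>M \<mu>"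
    using assms by (auto intro: measurable_component_singleton)
  show ?thesis
  proof (rule pair_measure_eqI[symmetric])
    show "sigma_finite_measure \<mu>" "sigma_finite_measure \<mu>" by unfold_locales
    fix A B assume AB [measurable]: "A \<in> sets \<mu>" "B \<in> sets \<mu>"
    define X where "X k = (if k = i then A else B)" for k
    have "emeasure (distr (PiM I (\<lambda>_. \<mu>)) (\<mu> \<Otimes>\<^sub>M \<mu>) (\<lambda>\<omega>. (\<omega> i, \<omega> j))) (A \<times> B)
        = emeasure (PiM I (\<lambda>_. \<mu>)) {\<omega> \<in> space (PiM I (\<lambda>_. \<mu>)). \<forall>k\<in>{i, j}. \<omega> k \<in> X k}"
      using assms by (subst emeasure_distr) (auto simp: X_def intro!: arg_cong2[of _ _ _ _ emeasure])
    also have "\<dots> = (\<Prod>k\<in>{i, j}. emeasure \<mu> (X k))"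
      using assms AB by (intro P.emeasure_PiM_Collect) (auto simp: X_def)
    also have "\<dots> = emeasure \<mu> A * emeasure \<mu> B"
      using assms by (simp add: X_def)
    finally show "emeasure \<mu> A * emeasure \<mu> B =
      emeasure (distr (PiM I (\<lambda>_. \<mu>)) (\<mu> \<Otimes>\<^sub>M \<mu>) (\<lambda>\<omega>. (\<omega> i, \<omega> j))) (A \<times> B)" ..
  qed simp
qed

text \<open>Draw \<open>n\<close> points independently from \<mu>. Almost surely they are distinct
  and lie in \<open>K\<close>, so the bound on pair products applies to them. Taking logarithms and
  expectations, each of the n(n - 1) ordered pairs contributes one copy of the energy.\<close>

lemma energy_integral_ge:
  fixes B :: "nat \<Rightarrow> real"
  assumes \<mu>: "\<mu> \<in> borel_prob_measures_on K" and "n \<ge> 2"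
    and B: "\<And>k. \<exists>p. lead_coeff p = 1 \<and> degree p = k \<and> (\<forall>z\<in>K. cmod (poly p z) \<le> B k)"
    and B_pos: "\<And>k. B k > 0"
    and ne: "AE x in \<mu> \<Otimes>\<^sub>M \<mu>. fst x \<noteq> snd x"
    and int: "integrable (\<mu> \<Otimes>\<^sub>M \<mu>) (\<lambda>x. ln (1 / cmod (fst x - snd x)))"
  shows "- 2 * (\<Sum>k<n. ln (real (Suc k) * B k)) \<le>
    real n * (real n - 1) * (\<integral>x. ln (1 / cmod (fst x - snd x)) \<partial>(\<mu> \<Otimes>\<^sub>M \<mu>))"
proof -
  interpret \<mu>: prob_space \<mu>
    using \<mu> by (simp add: borel_prob_measures_on_def)
  have sets_\<mu> [measurable_cong]: "sets \<mu> = sets borel"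
    using \<mu> by (simp add: borel_prob_measures_on_def)
  have K: "AE z in \<mu>. z \<in> K"
    using \<mu> by (simp add: borel_prob_measures_on_def)
  define P where "P = PiM {..<n} (\<lambda>_. \<mu>)"
  interpret PP: product_prob_space "\<lambda>_. \<mu>" "{..<n}" ..
  interpret P: prob_space P
    unfolding P_def by (intro prob_space_PiM \<mu>.prob_space_axioms)
  define h where "h x = ln (1 / cmod (fst x - snd x))" for x :: "complex \<times> complex"
  have pair: "distr P (\<mu> \<Otimes>\<^sub>M \<mu>) (\<lambda>\<omega>. (\<omega> i, \<omega> j)) = \<mu> \<Otimes>\<^sub>M \<mu>"
    if "i < n" "j < n" "i \<noteq> j" for i j
    unfolding P_def using that by (intro distr_PiM_pair) (auto intro: \<mu>.prob_space_axioms)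
  have meas: "(\<lambda>\<omega>. (\<omega> i, \<omega> j)) \<in> P \<rightarrow>\<^sub>M \<mu> \<Otimes>\<^sub>M \<mu>" if "i < n" "j < n" for i j
    unfolding P_def using that by (intro measurable_Pair measurable_component_singleton) auto
  have hmeas [measurable]: "h \<in> borel_measurable (\<mu> \<Otimes>\<^sub>M \<mu>)"
    unfolding h_def by measurable
  have int_h: "integrable P (\<lambda>\<omega>. h (\<omega> i, \<omega> j))"
    and lint_h: "(\<integral>\<omega>. h (\<omega> i, \<omega> j) \<partial>P) = (\<integral>x. h x \<partial>(\<mu> \<Otimes>\<^sub>M \<mu>))"
    if "i < n" "j < n" "i \<noteq> j" for i j
    using integrable_distr_eq[OF meas[OF that(1,2)] hmeas]
      integral_distr[OF meas[OF that(1,2)] hmeas] pair[OF that] int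
    by (simp_all add: h_def[abs_def])
  have "AE \<omega> in P. \<omega> i \<in> K" if "i < n" for i
    unfolding P_def using that K by (intro AE_PiM_component) (auto intro: \<mu>.prob_space_axioms)
  then have AE_K: "AE \<omega> in P. \<forall>i\<in>{..<n}. \<omega> i \<in> K"
    by (intro AE_finite_allI) auto
  have "AE \<omega> in P. \<omega> i \<noteq> \<omega> j" if "i < n" "j < n" "i \<noteq> j" for i j
    using AE_distrD[OF meas[OF that(1,2)], of "\<lambda>x. fst x \<noteq> snd x", unfolded pair[OF that], OF ne] by simp
  then have "AE \<omega> in P. \<forall>j\<in>{..<n} - {i}. \<omega> i \<noteq> \<omega> j" if "i < n" for i
    using that by (intro AE_finite_allI) auto
  then have AE_inj: "AE \<omega> in P. \<forall>i\<in>{..<n}. \<forall>j\<in>{..<n} - {i}. \<omega> i \<noteq> \<omega> j"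
    by (rule AE_finite_allI[OF finite_lessThan]) auto
  have "AE \<omega> in P. - 2 * (\<Sum>k<n. ln (real (Suc k) * B k)) \<le> (\<Sum>i<n. \<Sum>j\<in>{..<n} - {i}. h (\<omega> i, \<omega> j))"
    using AE_K AE_inj
  proof eventually_elim
    case (elim \<omega>)
    have inj: "inj_on \<omega> {..<n}"
      using elim(2) by (auto simp: inj_on_def)
    \<comment> \<open>Injectivity of \<omega> lets products over indices be read as products over
      the point set, so that the sum over pairs is -ln of \<open>pair_product A\<close>.\<close>
    define A where "A = \<omega> ` {..<n}"
    have A: "A \<subseteq> K" "finite A" "card A = n"
      using elim(1) inj by (auto simp: A_def card_image)
    have img: "A - {\<omega> i} = \<omega> ` ({..<n} - {i})" if "i < n" for i
      using inj that by (auto simp: A_def inj_on_def)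
    have inj': "inj_on \<omega> ({..<n} - {i})" for i
      using inj by (rule inj_on_subset) auto
    have "pair_product A = (\<Prod>i<n. \<Prod>j\<in>{..<n} - {i}. cmod (\<omega> i - \<omega> j))"
      unfolding pair_product_def
      by (subst A_def, subst prod.reindex[OF inj]) (auto simp: img prod.reindex[OF inj'] intro!: prod.cong)
    moreover have "ln (\<Prod>i<n. \<Prod>j\<in>{..<n} - {i}. cmod (\<omega> i - \<omega> j))
        = (\<Sum>i<n. ln (\<Prod>j\<in>{..<n} - {i}. cmod (\<omega> i - \<omega> j)))"
      using elim(2) by (intro ln_prod) (auto simp: prod_zero_iff)
    moreover have "\<dots> = (\<Sum>i<n. \<Sum>j\<in>{..<n} - {i}. ln (cmod (\<omega> i - \<omega> j)))"
      using elim(2) by (intro sum.cong ln_prod) auto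
    ultimately have "ln (pair_product A) = (\<Sum>i<n. \<Sum>j\<in>{..<n} - {i}. ln (cmod (\<omega> i - \<omega> j)))"
      by simp
    also have "\<dots> = - (\<Sum>i<n. \<Sum>j\<in>{..<n} - {i}. h (\<omega> i, \<omega> j))"
      using elim(2) unfolding h_def sum_negf[symmetric] by (intro sum.cong) (auto simp: ln_div)
    finally have 1: "(\<Sum>i<n. \<Sum>j\<in>{..<n} - {i}. h (\<omega> i, \<omega> j)) = - ln (pair_product A)"
      by simp
    have "pair_product A \<le> (\<Prod>k<n. real (Suc k) * B k)\<^sup>2"
      using pair_product_le[OF B A(1,2)] A(3) by simp
    moreover have Q: "0 < (\<Prod>k<n. real (Suc k) * B k)"
      by (intro prod_pos mult_pos_pos B_pos) auto
    ultimately have "ln (pair_product A) \<le> ln ((\<Prod>k<n. real (Suc k) * B k)\<^sup>2)"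
      using pair_product_pos[OF A(2)] by (intro ln_mono)
    also have "\<dots> = 2 * ln (\<Prod>k<n. real (Suc k) * B k)"
      using Q by (simp add: ln_realpow del: of_nat_Suc)
    also have "ln (\<Prod>k<n. real (Suc k) * B k) = (\<Sum>k<n. ln (real (Suc k) * B k))"
    proof (rule ln_prod)
      show "real (Suc k) * B k \<noteq> 0" for k
        using B_pos[of k] by simp
    qed simp
    finally show ?case
      using 1 by simp
  qed
  then have "(\<integral>\<omega>. - 2 * (\<Sum>k<n. ln (real (Suc k) * B k)) \<partial>P)
      \<le> (\<integral>\<omega>. (\<Sum>i<n. \<Sum>j\<in>{..<n} - {i}. h (\<omega> i, \<omega> j)) \<partial>P)"
    by (intro integral_mono_AE Bochner_Integration.integrable_sum int_h P.integrable_const) auto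
  also have "\<dots> = (\<Sum>i<n. \<Sum>j\<in>{..<n} - {i}. (\<integral>\<omega>. h (\<omega> i, \<omega> j) \<partial>P))"
  proof (subst Bochner_Integration.integral_sum)
    show "integrable P (\<lambda>\<omega>. \<Sum>j\<in>{..<n} - {i}. h (\<omega> i, \<omega> j))" if "i \<in> {..<n}" for i
      using that by (intro Bochner_Integration.integrable_sum int_h) auto
    show "(\<Sum>i<n. \<integral>\<omega>. (\<Sum>j\<in>{..<n} - {i}. h (\<omega> i, \<omega> j)) \<partial>P)
        = (\<Sum>i<n. \<Sum>j\<in>{..<n} - {i}. \<integral>\<omega>. h (\<omega> i, \<omega> j) \<partial>P)"
      by (intro sum.cong refl Bochner_Integration.integral_sum int_h) auto
  qed
  also have "\<dots> = (\<Sum>i<n. \<Sum>j\<in>{..<n} - {i}. (\<integral>x. h x \<partial>(\<mu> \<Otimes>\<^sub>M \<mu>)))"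
    by (intro sum.cong refl lint_h) auto
  also have "\<dots> = real n * (real n - 1) * (\<integral>x. h x \<partial>(\<mu> \<Otimes>\<^sub>M \<mu>))"
    using assms(2) by (simp add: card_Diff_singleton of_nat_diff)
  finally show ?thesis
    by (simp add: h_def P.prob_space)
qed

text \<open>Powers of \<open>p\<close> times a monomial give monic polynomials of every degree k,
  bounded by a constant times M^(k/d). Inserted into the bound for \<open>n\<close> random points,
  the constant and the factors k + 1 cost only O(ln n / n), which vanishes in the limit.\<close>

lemma energy_lower_bound:
  assumes \<mu>: "\<mu> \<in> borel_prob_measures_on K" and "bounded K"
    and p: "lead_coeff p = 1" "degree p = d" "d > 0" "\<And>z. z \<in> K \<Longrightarrow> cmod (poly p z) \<le> M" "M > 0"
  shows "ereal (- (ln M / real d)) \<le> log_energy \<mu>"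
proof (cases "log_energy \<mu> = \<infinity>")
  case False
  note * = log_energy_finiteD[OF \<mu> \<open>bounded K\<close> False]
  define I where "I = (\<integral>x. ln (1 / cmod (fst x - snd x)) \<partial>(\<mu> \<Otimes>\<^sub>M \<mu>))"
  obtain R0 where R0: "\<And>z. z \<in> K \<Longrightarrow> cmod z \<le> R0"
    using \<open>bounded K\<close> by (auto simp: bounded_iff)
  define R where "R = max 1 R0"
  \<comment> \<open>\<open>C\<close> absorbs the remainder of k modulo d: the factor R^d bounds z^(k
    mod d), and max 1 (1/M) pays for replacing M^(k div d) by M^(k/d).\<close>
  define C where "C = (max 1 (1 / M)) * R ^ d"
  have R: "R \<ge> 1" "\<And>z. z \<in> K \<Longrightarrow> cmod z \<le> R"
    using R0 by (auto simp: R_def le_max_iff_disj)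
  have C: "C \<ge> 1"
    unfolding C_def using R by (intro mult_ge1_I one_le_power) auto
  define B where "B k = C * M powr (real k / real d)" for k
  have B_pos: "B k > 0" for k
    using C \<open>M > 0\<close> by (simp add: B_def)
  have B: "\<exists>q. lead_coeff q = 1 \<and> degree q = k \<and> (\<forall>z\<in>K. cmod (poly q z) \<le> B k)" for k
  proof (intro exI conjI ballI)
    define q where "q = p ^ (k div d) * monom 1 (k mod d)"
    have "p \<noteq> 0"
      using p by auto
    show "lead_coeff q = 1"
      by (simp add: q_def lead_coeff_mult lead_coeff_power p(1) degree_monom_eq)
    show "degree q = k"
      using \<open>p \<noteq> 0\<close> p by (simp add: q_def degree_mult_eq degree_power_eq degree_monom_eq)
    fix z assume z: "z \<in> K"
    have "cmod (poly q z) = cmod (poly p z) ^ (k div d) * cmod z ^ (k mod d)"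
      by (simp add: q_def poly_monom norm_mult norm_power)
    also have "\<dots> \<le> M ^ (k div d) * R ^ d"
    proof (intro mult_mono power_mono)
      have "cmod z ^ (k mod d) \<le> R ^ (k mod d)"
        using R(2)[OF z] by (intro power_mono) auto
      also have "\<dots> \<le> R ^ d"
        using R p by (intro power_increasing) (auto intro: less_imp_le)
      finally show "cmod z ^ (k mod d) \<le> R ^ d" .
    qed (use p z in auto)
    also have "M ^ (k div d) \<le> max 1 (1 / M) * M powr (real k / real d)"
    proof -
      \<comment> \<open>\<open>e\<close> is the fractional part of k/d; whether M is above or below
        1 decides which of the two bounds on \<open>e\<close> is used.\<close>
      define e where "e = real k / real d - real (k div d)"
      have "real k = real (k div d) * real d + real (k mod d)"
        by (metis div_mult_mod_eq of_nat_add of_nat_mult)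
      then have e: "e = real (k mod d) / real d"
        using p by (simp add: e_def field_simps)
      then have "0 \<le> e" "e \<le> 1"
        using p by (auto simp: divide_le_eq less_imp_le)
      have "M powr (- e) \<le> max 1 (1 / M)"
      proof (cases "M \<ge> 1")
        case True
        then have "M powr (- e) \<le> M powr 0"
          using \<open>0 \<le> e\<close> by (intro powr_mono) auto
        then show ?thesis using p by simp
      next
        case False
        then have "(1 / M) powr e \<le> (1 / M) powr 1"
          using \<open>e \<le> 1\<close> p by (intro powr_mono) auto
        moreover have "(1 / M) powr e = M powr (- e)"
          using p by (simp add: powr_minus powr_divide field_simps)
        ultimately show ?thesis using p by simp
      qed
      moreover have "M ^ (k div d) = M powr (- e) * M powr (real k / real d)"
        using p by (simp add: e_def powr_realpow flip: powr_add)
      ultimately show ?thesis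
        using p by (simp add: mult_right_mono)
    qed
    finally show "cmod (poly q z) \<le> B k"
      using R by (simp add: B_def C_def mult_ac mult_right_mono)
  qed
  define L where "L = ln M / real d"
  \<comment> \<open>This is \<open>energy_integral_ge\<close> divided by n(n - 1). The terms
    \<open>real k * L\<close> sum to n(n - 1)/2 times \<open>L\<close>, so they contribute exactly
    \<open>- L\<close>.\<close>
  have bound: "- L - 2 * (ln (real n) + ln C) / (real n - 1) \<le> I" if n: "n \<ge> 2" for n
  proof -
    have "(\<Sum>k<n. ln (real (Suc k) * B k)) \<le> (\<Sum>k<n. ln (real n) + ln C + real k * L)"
    proof (rule sum_mono)
      fix k assume "k \<in> {..<n}"
      then have "ln (real (Suc k)) \<le> ln (real n)"
        by (subst ln_le_cancel_iff) auto
      moreover have "ln (real (Suc k) * B k) = ln (real (Suc k)) + ln (B k)"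
        using B_pos by (subst ln_mult_pos) auto
      moreover have "ln (B k) = ln C + real k * L"
        unfolding L_def using C \<open>M > 0\<close> unfolding B_def by (subst ln_mult_pos) (auto simp: ln_powr)
      ultimately show "ln (real (Suc k) * B k) \<le> ln (real n) + ln C + real k * L"
        by simp
    qed
    also have "\<dots> = real n * (ln (real n) + ln C) + (\<Sum>k<n. real k) * L"
      by (simp add: sum.distrib sum_distrib_right)
    also have "(\<Sum>k<n. real k) = real n * (real n - 1) / 2"
      by (induction n) (auto simp: field_simps)
    finally have "- 2 * (real n * (ln (real n) + ln C) + real n * (real n - 1) / 2 * L)
       \<le> real n * (real n - 1) * I"
      using energy_integral_ge[OF \<mu> n B B_pos *(1,2)] by (simp add: I_def)
    also have "- 2 * (real n * (ln (real n) + ln C) + real n * (real n - 1) / 2 * L)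
        = real n * (- 2 * (ln (real n) + ln C) - (real n - 1) * L)"
      by (simp add: field_simps)
    finally have "real n * (- 2 * (ln (real n) + ln C) - (real n - 1) * L) \<le> real n * ((real n - 1) * I)"
      by (simp add: mult.assoc)
    then have "- 2 * (ln (real n) + ln C) - (real n - 1) * L \<le> (real n - 1) * I"
      using n by (subst (asm) mult_le_cancel_left_pos) auto
    then have "(real n - 1) * (- L - 2 * (ln (real n) + ln C) / (real n - 1)) \<le> (real n - 1) * I"
      using n by (simp add: right_diff_distrib)
    then show ?thesis
      using n by (subst (asm) mult_le_cancel_left_pos) auto
  qed
  have "(\<lambda>n. - L - 2 * (ln (real n) + ln C) / (real n - 1)) \<longlonglongrightarrow> - L"
    by real_asymp
  then have "- L \<le> I"
    by (rule tendsto_upperbound[OF _ eventually_sequentiallyI[of 2]]) (use bound in auto)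
  then show ?thesis
    using *(3) by (simp add: I_def L_def)
qed auto

section \<open>Smearing out point masses\<close>

text \<open>On the disc \<open>N\<close> has a holomorphic logarithm \<open>L\<close>, and ln |N| is
  its real part. The mean value property is the real part of Cauchy's integral formula for
  \<open>L\<close>.\<close>

lemma has_integral_ln_norm_circle:
  fixes \<rho> :: real
  assumes N: "N holomorphic_on ball 0 R" "\<And>z. z \<in> ball 0 R \<Longrightarrow> N z \<noteq> 0" and "0 < \<rho>" "\<rho> < R"
  shows "((\<lambda>x. ln (cmod (N (\<rho> * cis (2 * pi * x))))) has_integral ln (cmod (N 0))) {0..1}"
proof -
  have "simply_connected (ball (0::complex) R)"
    by (simp add: convex_imp_simply_connected)
  then obtain L where L: "L holomorphic_on ball 0 R" "\<And>z. z \<in> ball 0 R \<Longrightarrow> N z = exp (L z)"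
    using simply_connected_eq_holomorphic_log[of "ball (0::complex) R"] N by auto
  have "L holomorphic_on cball 0 \<rho>"
    using L(1) by (rule holomorphic_on_subset) (use assms in auto)
  then have "((\<lambda>u. L u / (u - 0)) has_contour_integral 2 * of_real pi * \<i> * L 0) (circlepath 0 \<rho>)"
    using assms by (intro Cauchy_integral_circlepath_simple) auto
  then have "((\<lambda>x. (2 * of_real pi * \<i>) * L (\<rho> * cis (2 * pi * x))) has_integral
      2 * of_real pi * \<i> * L 0) {0..1}"
    unfolding has_contour_integral_def
  proof (rule has_integral_eq[rotated])
    fix x :: real assume x: "x \<in> {0..1}"
    have exp: "exp (2 * of_real pi * \<i> * of_real x) = cis (2 * pi * x)"
      by (simp add: cis_conv_exp mult_ac)
    have "vector_derivative (circlepath 0 \<rho>) (at x within {0..1}) = 2 * of_real pi * \<i> * (\<rho> * cis (2 * pi * x))"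
      using vector_derivative_circlepath01[of x 0 \<rho>] x unfolding exp by simp
    moreover have "circlepath 0 \<rho> x = \<rho> * cis (2 * pi * x)"
      unfolding circlepath exp by simp
    ultimately show "L (circlepath 0 \<rho> x) / (circlepath 0 \<rho> x - 0) *
        vector_derivative (circlepath 0 \<rho>) (at x within {0..1}) =
      2 * of_real pi * \<i> * L (\<rho> * cis (2 * pi * x))"
      using \<open>0 < \<rho>\<close> by simp
  qed
  from has_integral_mult_right[OF this, of "1 / (2 * of_real pi * \<i>)"]
  have "((\<lambda>x. L (\<rho> * cis (2 * pi * x))) has_integral L 0) {0..1}"
    by simp
  from has_integral_linear[OF this bounded_linear_Re]
  have *: "((\<lambda>x. Re (L (\<rho> * cis (2 * pi * x)))) has_integral Re (L 0)) {0..1}"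
    by (simp add: o_def)
  have "ln (cmod (N z)) = Re (L z)" if "z \<in> ball 0 R" for z
    using L(2)[OF that] by simp
  moreover have "\<rho> * cis (2 * pi * x) \<in> ball 0 R" for x
    using assms by (simp add: norm_mult)
  ultimately show ?thesis
    using * assms by simp
qed

text \<open>For \<rho> < |z| the function z - u has no zero in the disc of radius |z|. For \<rho> >
  |z| it is replaced by \<rho> - cnj z * u / \<rho>, which has the same modulus on the circle |u| =
  \<rho>, value \<rho> at 0, and no zero in the closed disc.\<close>

lemma has_integral_ln_dist_circle:
  fixes \<rho> :: real
  assumes "0 < \<rho>" "\<rho> \<noteq> cmod z"
  shows "((\<lambda>x. ln (cmod (z - \<rho> * cis (2 * pi * x)))) has_integral ln (max (cmod z) \<rho>)) {0..1}"
proof (cases "\<rho> < cmod z")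
  case True
  have "(\<lambda>u. z - u) holomorphic_on ball 0 (cmod z)"
    by (intro holomorphic_intros)
  moreover have "z - u \<noteq> 0" if "u \<in> ball 0 (cmod z)" for u
    using that by auto
  ultimately have "((\<lambda>x. ln (cmod (z - \<rho> * cis (2 * pi * x)))) has_integral ln (cmod (z - 0))) {0..1}"
    using assms True by (intro has_integral_ln_norm_circle) auto
  then show ?thesis
    using True by simp
next
  case False
  with assms have less: "cmod z < \<rho>" by simp
  \<comment> \<open>The zero of the replacement function is the reflection of \<open>z\<close> in
    the circle, at distance \<rho>^2 / |z| from 0. For z = 0 there is no zero, and any radius above
    \<rho> would do.\<close>
  define R where "R = (if z = 0 then 2 * \<rho> else \<rho>\<^sup>2 / cmod z)"
  have "\<rho> < R"
    using less assms by (auto simp: R_def field_simps power2_eq_square)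
  have ne: "of_real \<rho> - cnj z * u / of_real \<rho> \<noteq> 0" if "u \<in> ball 0 R" for u
  proof
    assume *: "of_real \<rho> - cnj z * u / of_real \<rho> = 0"
    with assms have "of_real (\<rho>\<^sup>2) = cnj z * u"
      by (simp add: field_simps power2_eq_square)
    then have "\<rho>\<^sup>2 = cmod z * cmod u"
      using assms by (metis abs_power2 complex_mod_cnj norm_mult norm_of_real)
    with that assms show False
      by (cases "z = 0") (auto simp: R_def field_simps)
  qed
  have "cmod (of_real \<rho> - cnj z * (\<rho> * cis (2 * pi * x)) / of_real \<rho>) = cmod (z - \<rho> * cis (2 * pi * x))" for x
  proof -
    define c where "c = cis (2 * pi * x)"
    have "z - \<rho> * c = - c * cnj (of_real \<rho> - cnj z * c)"
      by (simp add: algebra_simps c_def) (simp add: cis_cnj cis_mult flip: mult.assoc)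
    then have "cmod (z - \<rho> * c) = cmod (of_real \<rho> - cnj z * c)"
      by (simp add: norm_mult c_def del: complex_cnj_diff)
    moreover have "cnj z * (\<rho> * c) / of_real \<rho> = cnj z * c"
      using assms by simp
    ultimately show ?thesis
      by (simp add: c_def)
  qed
  moreover have "((\<lambda>x. ln (cmod (of_real \<rho> - cnj z * (\<rho> * cis (2 * pi * x)) / of_real \<rho>)))
      has_integral ln (cmod (of_real \<rho> - cnj z * 0 / of_real \<rho>))) {0..1}"
    using ne assms \<open>\<rho> < R\<close> by (intro has_integral_ln_norm_circle[of _ R]) (auto intro!: holomorphic_intros)
  ultimately show ?thesis
    using less assms by (simp add: max_def)
qed

section \<open>Averages over annuli\<close>

definition annulus_point :: "real \<Rightarrow> complex \<Rightarrow> real \<times> real \<Rightarrow> complex" where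
  "annulus_point r a = (\<lambda>(s, x). a + of_real (r * (1 + s) / 2) * cis (2 * pi * x))"

text \<open>The mean is uniform in the radius, between r/2 and r, and in the angle, not in area.
  Varying the radius makes the circles through a given point negligible.\<close>

definition annulus_average :: "real \<Rightarrow> (complex \<Rightarrow> ennreal) \<Rightarrow> complex \<Rightarrow> ennreal" where
  "annulus_average r f a = (\<integral>\<^sup>+s. (\<integral>\<^sup>+x. f (annulus_point r a (s, x)) * indicator {0..1} x \<partial>lborel)
     * indicator {0..1} s \<partial>lborel)"

text \<open>Used for \<open>C\<close> with \<open>exp C\<close> at least the distances that occur, so that \<^const>\<open>ennreal\<close> does not
  cut off negative values.\<close>

definition truncated_kernel :: "real \<Rightarrow> complex \<Rightarrow> complex \<Rightarrow> ennreal" where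
  "truncated_kernel C z w = (if z = w then \<infinity> else ennreal (C - ln (cmod (z - w))))"

lemma truncated_kernel_measurable [measurable]:
  "(\<lambda>x. truncated_kernel C (fst x) (snd x)) \<in> borel_measurable (borel \<Otimes>\<^sub>M borel)"
  unfolding truncated_kernel_def by measurable

lemma annulus_point_measurable [measurable]:
  "annulus_point r a \<in> borel_measurable (borel \<Otimes>\<^sub>M borel)"
proof -
  have "(\<lambda>x::real. cis (2 * pi * x)) \<in> borel_measurable borel"
    by (intro borel_measurable_continuous_onI continuous_intros)
  then have [measurable]: "(\<lambda>p::real\<times>real. cis (2 * pi * snd p)) \<in> borel_measurable (borel \<Otimes>\<^sub>M borel)"
    by measurable
  show ?thesis
    unfolding annulus_point_def case_prod_beta by measurable
qed

lemma dist_annulus_point: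
  assumes "0 < r" "s \<in> {0..1}"
  shows "dist (annulus_point r a (s, x)) a = r * (1 + s) / 2"
  using assms by (simp add: annulus_point_def dist_norm norm_mult del: of_real_add of_real_mult of_real_divide)

lemma annulus_point_mem_cball:
  assumes "0 < r" "s \<in> {0..1}"
  shows "annulus_point r a (s, x) \<in> cball a r"
  using assms by (simp add: dist_annulus_point dist_commute[of a])

lemma annulus_average_mono:
  assumes "0 < r" "\<And>z. z \<in> cball a r \<Longrightarrow> f z \<le> g z"
  shows "annulus_average r f a \<le> annulus_average r g a"
proof -
  have "(\<integral>\<^sup>+x. f (annulus_point r a (s, x)) * indicator {0..1} x \<partial>lborel)
      \<le> (\<integral>\<^sup>+x. g (annulus_point r a (s, x)) * indicator {0..1} x \<partial>lborel)" if "s \<in> {0..1}" for s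
    by (intro nn_integral_mono mult_right_mono assms(2) annulus_point_mem_cball[OF assms(1) that]) simp
  then show ?thesis
    unfolding annulus_average_def by (intro nn_integral_mono) (auto split: split_indicator)
qed

lemma nn_integral_indicator_unit_const:
  "(\<integral>\<^sup>+s. c * indicator {0..1::real} s \<partial>lborel) = c"
  by (simp add: nn_integral_cmult)

lemma annulus_average_const: "annulus_average r (\<lambda>_. c) a = c"
  by (simp add: annulus_average_def nn_integral_indicator_unit_const)

text \<open>On a circle of radius \<rho> about \<open>b\<close> that misses \<open>z\<close>, the
  mean of ln |z - u| is ln (max |z - b| \<rho>), and \<rho> is at least r/2. The condition on
  \<open>C\<close> keeps the integrand nonnegative, so that no truncation occurs.\<close>

lemma annulus_average_truncated_kernel_le:
  assumes r: "0 < r" and C: "cmod (z - b) + r \<le> exp C"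
  shows "annulus_average r (truncated_kernel C z) b \<le> ennreal (C - ln (max (cmod (z - b)) (r / 2)))"
proof -
  define c where "c = ennreal (C - ln (max (cmod (z - b)) (r / 2)))"
  have inner: "(\<integral>\<^sup>+x. truncated_kernel C z (annulus_point r b (s, x)) * indicator {0..1} x \<partial>lborel) \<le> c"
    if s: "s \<in> {0..1}" "r * (1 + s) / 2 \<noteq> cmod (z - b)" for s
  proof -
    define \<rho> where "\<rho> = r * (1 + s) / 2"
    have \<rho>: "0 < \<rho>" "\<rho> \<noteq> cmod (z - b)" "\<rho> \<le> r" "r / 2 \<le> \<rho>"
      using s r by (auto simp: \<rho>_def)
    have ne: "z \<noteq> annulus_point r b (s, x)" for x
      using dist_annulus_point[OF r s(1), of b x] s(2) by (auto simp: dist_norm)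
    have eq: "cmod (z - annulus_point r b (s, x)) = cmod (z - b - \<rho> * cis (2 * pi * x))" for x
      by (simp add: annulus_point_def \<rho>_def algebra_simps)
    have "((\<lambda>x. C - ln (cmod (z - b - \<rho> * cis (2 * pi * x)))) has_integral
        (C * 1 - ln (max (cmod (z - b)) \<rho>))) {0..1}"
      using has_integral_const_real[of C 0 1]
      by (intro has_integral_diff has_integral_ln_dist_circle \<rho>) auto
    moreover have "0 \<le> C - ln (cmod (z - b - \<rho> * cis (2 * pi * x)))" for x
    proof -
      have "cmod (z - b - \<rho> * cis (2 * pi * x)) \<le> cmod (z - b) + \<rho>"
        using norm_triangle_ineq4[of "z - b" "\<rho> * cis (2 * pi * x)"] \<rho> by (simp add: norm_mult)
      then have "cmod (z - b - \<rho> * cis (2 * pi * x)) \<le> exp C"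
        using C \<rho> by linarith
      moreover have "0 < cmod (z - b - \<rho> * cis (2 * pi * x))"
        using ne[of x] unfolding eq[symmetric] by simp
      ultimately have "ln (cmod (z - b - \<rho> * cis (2 * pi * x))) \<le> ln (exp C)"
        by (rule ln_mono)
      then show ?thesis by simp
    qed
    ultimately have "(\<integral>\<^sup>+x. ennreal (C - ln (cmod (z - b - \<rho> * cis (2 * pi * x)))) * indicator {0..1} x \<partial>lborel)
        = ennreal (C - ln (max (cmod (z - b)) \<rho>))"
      by (subst nn_integral_has_integral_lebesgue') auto
    then have "(\<integral>\<^sup>+x. truncated_kernel C z (annulus_point r b (s, x)) * indicator {0..1} x \<partial>lborel)
        = ennreal (C - ln (max (cmod (z - b)) \<rho>))"
      using ne by (simp add: truncated_kernel_def eq)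
    also have "\<dots> \<le> c"
      unfolding c_def using \<rho> r
      by (intro ennreal_leI diff_left_mono ln_mono) (auto simp: less_max_iff_disj)
    finally show ?thesis .
  qed
  have "annulus_average r (truncated_kernel C z) b \<le> (\<integral>\<^sup>+s. c * indicator {0..1::real} s \<partial>lborel)"
    unfolding annulus_average_def
  proof (rule nn_integral_mono_AE)
    \<comment> \<open>The excluded \<open>s\<close> is the one whose circle passes through
      \<open>z\<close>.\<close>
    have "AE s in lborel. s \<noteq> 2 * cmod (z - b) / r - 1"
      by (rule AE_lborel_singleton)
    then show "AE s in lborel.
       (\<integral>\<^sup>+x. truncated_kernel C z (annulus_point r b (s, x)) * indicator {0..1} x \<partial>lborel)
         * indicator {0..1} s \<le> c * indicator {0..1} s"
    proof eventually_elim
      case (elim s)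
      then have "r * (1 + s) / 2 \<noteq> cmod (z - b)"
        using r by (auto simp: field_simps)
      then show ?case
        using inner[of s] by (auto split: split_indicator)
    qed
  qed
  then show ?thesis
    by (simp add: nn_integral_indicator_unit_const c_def)
qed

text \<open>The law of a random point: a centre drawn uniformly from \<open>A\<close>, with
  independent uniform radius and angle parameters. Its integrals are the means over \<open>A\<close>
  of annulus averages.\<close>

definition smoothed_measure :: "real \<Rightarrow> complex set \<Rightarrow> complex measure" where
  "smoothed_measure r A = distr (measure_pmf (pmf_of_set A) \<Otimes>\<^sub>M
     (uniform_measure lborel {0..1} \<Otimes>\<^sub>M uniform_measure lborel {0..1})) borel
     (\<lambda>(a, p). annulus_point r a p)"

lemma sets_smoothed_measure [measurable_cong, simp]: "sets (smoothed_measure r A) = sets borel"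
  by (simp add: smoothed_measure_def)

lemma space_smoothed_measure [simp]: "space (smoothed_measure r A) = UNIV"
  by (simp add: smoothed_measure_def)

context
  fixes A :: "complex set" and r :: real
  assumes A: "finite A" "A \<noteq> {}"
begin

lemma nn_integral_smoothed_measure:
  assumes [measurable]: "f \<in> borel_measurable borel"
  shows "(\<integral>\<^sup>+z. f z \<partial>smoothed_measure r A) = (\<Sum>a\<in>A. annulus_average r f a) / of_nat (card A)"
proof -
  define U where "U = uniform_measure lborel {0..1::real}"
  interpret U: prob_space U
    unfolding U_def by (intro prob_space_uniform_measure) auto
  interpret UU: pair_prob_space U U ..
  have sets_U [measurable_cong]: "sets U = sets borel"
    by (simp add: U_def)
  have nn_U: "(\<integral>\<^sup>+x. h x \<partial>U) = (\<integral>\<^sup>+x. h x * indicator {0..1} x \<partial>lborel)"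
    if "h \<in> borel_measurable borel" for h
    unfolding U_def using that by (subst nn_integral_uniform_measure) (auto simp: divide_ennreal_def)
  have fst [measurable]: "fst \<in> borel_measurable (measure_pmf (pmf_of_set A) \<Otimes>\<^sub>M (U \<Otimes>\<^sub>M U))"
    by (rule measurable_compose[OF measurable_fst]) simp
  \<comment> \<open>The centre lives on a discrete space and the parameters on a product of Borel
    spaces; writing the point as a sum separates the two for joint measurability.\<close>
  have shift: "annulus_point r a p = a + annulus_point r 0 p" for a p
    by (simp add: annulus_point_def case_prod_beta)
  have meas [measurable]: "(\<lambda>x. annulus_point r (fst x) (snd x)) \<in>
      borel_measurable (measure_pmf (pmf_of_set A) \<Otimes>\<^sub>M (U \<Otimes>\<^sub>M U))"
    by (subst shift) measurable
  have "(\<integral>\<^sup>+z. f z \<partial>smoothed_measure r A) =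
      (\<integral>\<^sup>+x. f (annulus_point r (fst x) (snd x)) \<partial>(measure_pmf (pmf_of_set A) \<Otimes>\<^sub>M (U \<Otimes>\<^sub>M U)))"
    unfolding smoothed_measure_def U_def[symmetric] case_prod_beta
    by (rule nn_integral_distr) measurable
  also have "\<dots> = (\<integral>\<^sup>+a. \<integral>\<^sup>+p. f (annulus_point r a p) \<partial>(U \<Otimes>\<^sub>M U) \<partial>measure_pmf (pmf_of_set A))"
    by (subst UU.P.nn_integral_fst[symmetric]) auto
  also have "\<dots> = (\<Sum>a\<in>A. \<integral>\<^sup>+p. f (annulus_point r a p) \<partial>(U \<Otimes>\<^sub>M U)) / of_nat (card A)"
    using A by (subst nn_integral_pmf_of_set) auto
  also have "\<dots> = (\<Sum>a\<in>A. annulus_average r f a) / of_nat (card A)"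
  proof -
    have "(\<integral>\<^sup>+p. f (annulus_point r a p) \<partial>(U \<Otimes>\<^sub>M U)) = annulus_average r f a" for a
    proof -
      have m [measurable]: "(\<lambda>p. f (annulus_point r a p)) \<in> borel_measurable (U \<Otimes>\<^sub>M U)"
        by measurable
      have "(\<integral>\<^sup>+p. f (annulus_point r a p) \<partial>(U \<Otimes>\<^sub>M U)) = (\<integral>\<^sup>+s. \<integral>\<^sup>+x. f (annulus_point r a (s, x)) \<partial>U \<partial>U)"
        by (subst U.nn_integral_fst[symmetric]) auto
      also have "\<dots> = annulus_average r f a"
        unfolding annulus_average_def
        by (simp add: nn_U)
      finally show ?thesis .
    qed
    then show ?thesis by simp
  qed
  finally show ?thesis .
qed

lemma smoothed_measure_mem:
  assumes r: "0 < r" and E: "\<And>a. a \<in> A \<Longrightarrow> cball a r \<subseteq> E"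
  shows "smoothed_measure r A \<in> borel_prob_measures_on E"
proof -
  \<comment> \<open>\<open>E\<close> is an arbitrary set and may fail to be Borel, so the
    exceptional null set is the complement of the closed set \<open>F\<close> inside
    \<open>E\<close>.\<close>
  define F where "F = (\<Union>a\<in>A. cball a r)"
  have F: "closed F" "F \<subseteq> E"
    using A E by (auto simp: F_def)
  have "emeasure (smoothed_measure r A) UNIV = (\<integral>\<^sup>+z. 1 \<partial>smoothed_measure r A)"
    by simp
  also have "\<dots> = of_nat (card A) / of_nat (card A)"
    by (subst nn_integral_smoothed_measure) (auto simp: annulus_average_const)
  also have "\<dots> = 1"
    using A by (simp add: card_gt_0_iff ennreal_of_nat_eq_real_of_nat divide_ennreal)
  finally have "prob_space (smoothed_measure r A)"
    by (intro prob_spaceI) simp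
  moreover have "AE z in smoothed_measure r A. z \<in> F"
  proof (rule AE_I)
    have zero: "annulus_average r (indicator (- F)) a = 0" if "a \<in> A" for a
    proof -
      have "annulus_average r (indicator (- F)) a \<le> annulus_average r (\<lambda>_. 0) a"
        using r that by (intro annulus_average_mono) (auto simp: F_def split: split_indicator)
      then show ?thesis
        by (simp add: annulus_average_const)
    qed
    have "emeasure (smoothed_measure r A) (- F) = (\<integral>\<^sup>+z. indicator (- F) z \<partial>smoothed_measure r A)"
      using F by (subst nn_integral_indicator) auto
    also have "\<dots> = (\<Sum>a\<in>A. annulus_average r (indicator (- F)) a) / of_nat (card A)"
      using F by (subst nn_integral_smoothed_measure) auto
    finally show "emeasure (smoothed_measure r A) (- F) = 0"
      by (simp add: zero)
  qed (use F in \<open>auto simp: borel_closed\<close>)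
  ultimately show ?thesis
    using F(2) by (auto simp: borel_prob_measures_on_def elim!: eventually_mono)
qed

end

text \<open>Adding \<open>C\<close> makes the integrand nonnegative almost everywhere, so one
  nonnegative integral suffices; on a probability space the shift changes the integral by exactly
  \<open>C\<close>.\<close>

lemma ereal_integral_le:
  assumes "prob_space M" and [measurable]: "f \<in> borel_measurable M"
    and lower: "AE x in M. - ereal C \<le> f x"
    and upper: "(\<integral>\<^sup>+x. e2ennreal (f x + ereal C) \<partial>M) \<le> ennreal (B + C)" and "0 \<le> B + C"
  shows "ereal_integral M f \<le> ereal B"
proof -
  interpret prob_space M by fact
  have "(\<integral>\<^sup>+x. e2ennreal (f x + ereal C) \<partial>M) < \<infinity>"
    using upper by (rule le_less_trans) simp
  then have "AE x in M. e2ennreal (f x + ereal C) \<noteq> \<infinity>"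
    by (intro nn_integral_PInf_AE) auto
  then have real: "AE x in M. f x = ereal (real_of_ereal (f x)) \<and> - C \<le> real_of_ereal (f x)"
    using lower
  proof eventually_elim
    case (elim x)
    then show ?case by (cases "f x") auto
  qed
  define g where "g x = real_of_ereal (f x)" for x
  have [measurable]: "g \<in> borel_measurable M"
    unfolding g_def by measurable
  have g: "AE x in M. 0 \<le> g x + C"
    using real by eventually_elim (auto simp: g_def)
  have nn: "(\<integral>\<^sup>+x. ennreal (g x + C) \<partial>M) \<le> ennreal (B + C)"
  proof -
    have "(\<integral>\<^sup>+x. ennreal (g x + C) \<partial>M) = (\<integral>\<^sup>+x. e2ennreal (f x + ereal C) \<partial>M)"
    proof (rule nn_integral_cong_AE, use real in eventually_elim)
      case (elim x)
      then show ?case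
        by (metis e2ennreal_ereal g_def plus_ereal.simps(1))
    qed
    then show ?thesis
      using upper by simp
  qed
  have int': "integrable M (\<lambda>x. g x + C)"
    using g nn by (intro integrableI_nonneg) (auto intro: le_less_trans)
  then have int: "integrable M g"
    using Bochner_Integration.integrable_diff[OF int' integrable_const[of C]] by simp
  have "(\<integral>x. g x + C \<partial>M) \<le> B + C"
    using integral_eq_nn_integral[OF _ g] nn \<open>0 \<le> B + C\<close>
    by (simp add: enn2real_leI)
  then have "(\<integral>x. g x \<partial>M) \<le> B"
    using int by (simp add: prob_space)
  moreover have "ereal_integral M f = ereal (\<integral>x. g x \<partial>M)"
    using int by (rule ereal_integral_eq_integral) (use real in \<open>auto simp: g_def elim!: eventually_mono\<close>)
  ultimately show ?thesis
    by simp
qed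

lemma truncated_kernel_measurable' [measurable]:
  "truncated_kernel C z \<in> borel_measurable borel"
  unfolding truncated_kernel_def by measurable

lemma annulus_average_truncated_kernel_measurable:
  "(\<lambda>z. annulus_average r (truncated_kernel C z) b) \<in> borel_measurable borel"
proof -
  have [measurable]: "(\<lambda>x. annulus_point r b (s x, t x)) \<in> borel_measurable M"
    if [measurable]: "s \<in> borel_measurable M" "t \<in> borel_measurable M" for s t and M :: "'z measure"
    by measurable
  have "(\<lambda>x. truncated_kernel C (fst x) (annulus_point r b (snd x))) \<in>
    borel_measurable (borel \<Otimes>\<^sub>M (borel \<Otimes>\<^sub>M borel))"
    using measurable_compose[OF _ truncated_kernel_measurable,
      of "\<lambda>x. (fst x, annulus_point r b (snd x))" "borel \<Otimes>\<^sub>M (borel \<Otimes>\<^sub>M borel)" C] by simp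
  then have [measurable]: "(\<lambda>x. truncated_kernel C (f x) (annulus_point r b (s x, t x))) \<in> borel_measurable M"
    if "f \<in> borel_measurable M" "s \<in> borel_measurable M" "t \<in> borel_measurable M"
    for f s t and M :: "'z measure"
    using that measurable_compose[of "\<lambda>x. (f x, (s x, t x))" M "borel \<Otimes>\<^sub>M (borel \<Otimes>\<^sub>M borel)"
      "\<lambda>x. truncated_kernel C (fst x) (annulus_point r b (snd x))" borel] by simp
  show ?thesis
    unfolding annulus_average_def by measurable
qed

lemma annulus_average_sum_divide:
  fixes f :: "'b \<Rightarrow> complex \<Rightarrow> ennreal"
  assumes [measurable]: "\<And>b. b \<in> B \<Longrightarrow> f b \<in> borel_measurable borel"
  shows "annulus_average r (\<lambda>z. (\<Sum>b\<in>B. f b z) / c) a = (\<Sum>b\<in>B. annulus_average r (f b) a) / c"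
proof -
  have [measurable]: "(\<lambda>x. annulus_point r a (s, x)) \<in> borel_measurable borel" for s
    by measurable
  have "(\<integral>\<^sup>+x. (\<Sum>b\<in>B. f b (annulus_point r a (s, x))) / c * indicator {0..1} x \<partial>lborel) =
      (\<Sum>b\<in>B. \<integral>\<^sup>+x. f b (annulus_point r a (s, x)) * indicator {0..1} x \<partial>lborel) / c" for s
  proof -
    have "(\<integral>\<^sup>+x. (\<Sum>b\<in>B. f b (annulus_point r a (s, x))) / c * indicator {0..1} x \<partial>lborel) =
       (\<integral>\<^sup>+x. (\<Sum>b\<in>B. f b (annulus_point r a (s, x)) * indicator {0..1} x) / c \<partial>lborel)"
      by (intro nn_integral_cong) (auto split: split_indicator)
    also have "\<dots> = (\<Sum>b\<in>B. \<integral>\<^sup>+x. f b (annulus_point r a (s, x)) * indicator {0..1} x \<partial>lborel) / c"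
      by (subst nn_integral_divide, measurable, subst nn_integral_sum, measurable)
    finally show ?thesis .
  qed
  moreover have "(\<integral>\<^sup>+s. (\<Sum>b\<in>B. g b s) / c * indicator {0..1::real} s \<partial>lborel) =
      (\<Sum>b\<in>B. \<integral>\<^sup>+s. g b s * indicator {0..1} s \<partial>lborel) / c"
    if [measurable]: "\<And>b. b \<in> B \<Longrightarrow> g b \<in> borel_measurable borel" for g :: "'b \<Rightarrow> real \<Rightarrow> ennreal"
  proof -
    have "(\<integral>\<^sup>+s. (\<Sum>b\<in>B. g b s) / c * indicator {0..1::real} s \<partial>lborel) =
       (\<integral>\<^sup>+s. (\<Sum>b\<in>B. g b s * indicator {0..1} s) / c \<partial>lborel)"
      by (intro nn_integral_cong) (auto split: split_indicator)
    also have "\<dots> = (\<Sum>b\<in>B. \<integral>\<^sup>+s. g b s * indicator {0..1} s \<partial>lborel) / c"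
      by (subst nn_integral_divide, measurable, subst nn_integral_sum, measurable)
    finally show ?thesis .
  qed
  ultimately show ?thesis
    unfolding annulus_average_def by simp
qed

text \<open>Apply the annulus bound in both variables. For distinct centres smearing does not raise
  the interaction above that of the point masses; the infinite self-interaction of a point mass is
  replaced by at most ln (2 / r).\<close>

lemma log_energy_smoothed_measure_le:
  assumes A: "finite A" "A \<noteq> {}" and r: "0 < r"
  shows "log_energy (smoothed_measure r A) \<le>
    ereal (((\<Sum>a\<in>A. \<Sum>b\<in>A - {a}. ln (1 / cmod (a - b))) + real (card A) * ln (2 / r)) / (real (card A))\<^sup>2)"
proof -
  define N where "N = real (card A)"
  have N: "N > 0"
    using A by (simp add: N_def card_gt_0_iff)
  define S where "S = (\<Sum>a\<in>A. \<Sum>b\<in>A - {a}. ln (1 / cmod (a - b)))"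
  obtain D where D: "\<And>a b. a \<in> A \<Longrightarrow> b \<in> A \<Longrightarrow> cmod (a - b) \<le> D"
    using diameter_bounded_bound[OF finite_imp_bounded[OF A(1)]] by (force simp: dist_norm)
  have "D \<ge> 0"
    using A D by (metis ex_in_conv norm_ge_zero order_trans)
  \<comment> \<open>The discs of radius \<open>r\<close> about points of \<open>A\<close> have
    mutual distances at most D + 2r.\<close>
  define C where "C = ln (D + 2 * r)"
  have C: "exp C = D + 2 * r"
    unfolding C_def using \<open>D \<ge> 0\<close> r by simp
  define \<nu> where "\<nu> = smoothed_measure r A"
  have \<nu>_mem: "\<nu> \<in> borel_prob_measures_on (\<Union>a\<in>A. cball a r)"
    unfolding \<nu>_def using A r by (intro smoothed_measure_mem) auto
  interpret \<nu>: prob_space \<nu>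
    using \<nu>_mem by (simp add: borel_prob_measures_on_def)
  interpret \<nu>\<nu>: pair_prob_space \<nu> \<nu> ..
  have [measurable_cong]: "sets \<nu> = sets borel"
    by (simp add: \<nu>_def)
  have near: "cmod (z - b) + r \<le> exp C" if "z \<in> cball a r" "a \<in> A" "b \<in> A" for z a b
    using that D[of a b] C norm_triangle_ineq[of "z - a" "a - b"]
    by (auto simp: dist_norm norm_minus_commute)
  define T where "T a b = (if a = b then C + ln (2 / r) else C + ln (1 / cmod (a - b)))" for a b
  have T_eq: "T a b = (if a = b then C - ln (r / 2) else C - ln (cmod (a - b)))" for a b
    using r by (auto simp: T_def ln_div)
  have T_nonneg: "0 \<le> T a b" if "a \<in> A" "b \<in> A" for a b
  proof -
    have "ln (r / 2) \<le> ln (exp C)"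
      using r C \<open>D \<ge> 0\<close> by (intro ln_mono) auto
    moreover have "ln (cmod (a - b)) \<le> ln (exp C)" if "a \<noteq> b"
      using that C D[OF \<open>a \<in> A\<close> \<open>b \<in> A\<close>] r by (intro ln_mono) auto
    ultimately show ?thesis
      by (auto simp: T_eq)
  qed
  have avg: "annulus_average r (\<lambda>z. annulus_average r (truncated_kernel C z) b) a \<le> ennreal (T a b)"
    if "a \<in> A" "b \<in> A" for a b
  proof (cases "a = b")
    case True
    have "annulus_average r (\<lambda>z. annulus_average r (truncated_kernel C z) b) a
        \<le> annulus_average r (\<lambda>_. ennreal (C - ln (r / 2))) a"
    proof (rule annulus_average_mono[OF r])
      fix z assume "z \<in> cball a r"
      then have "annulus_average r (truncated_kernel C z) b \<le> ennreal (C - ln (max (cmod (z - b)) (r / 2)))"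
        using that near by (intro annulus_average_truncated_kernel_le r) auto
      also have "\<dots> \<le> ennreal (C - ln (r / 2))"
        using r by (intro ennreal_leI diff_left_mono ln_mono) auto
      finally show "annulus_average r (truncated_kernel C z) b \<le> ennreal (C - ln (r / 2))" .
    qed
    then show ?thesis
      using True by (simp add: annulus_average_const T_eq)
  next
    case False
    \<comment> \<open>The inner average is bounded by the kernel of the point mass at
      \<open>b\<close>, trivially so at z = b, and that kernel is then averaged over the annulus
      about \<open>a\<close>.\<close>
    have "annulus_average r (\<lambda>z. annulus_average r (truncated_kernel C z) b) a
        \<le> annulus_average r (truncated_kernel C b) a"
    proof (rule annulus_average_mono[OF r])
      fix z assume z: "z \<in> cball a r"
      show "annulus_average r (truncated_kernel C z) b \<le> truncated_kernel C b z"
      proof (cases "z = b")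
        case False
        then have "annulus_average r (truncated_kernel C z) b \<le> ennreal (C - ln (max (cmod (z - b)) (r / 2)))"
          using that z near by (intro annulus_average_truncated_kernel_le r) auto
        also have "\<dots> \<le> ennreal (C - ln (cmod (z - b)))"
          using False by (intro ennreal_leI diff_left_mono ln_mono) auto
        finally show ?thesis
          using False by (simp add: truncated_kernel_def norm_minus_commute)
      qed (simp add: truncated_kernel_def)
    qed
    also have "\<dots> \<le> ennreal (C - ln (max (cmod (b - a)) (r / 2)))"
      using that r near[of b b a] by (intro annulus_average_truncated_kernel_le r) auto
    also have "\<dots> \<le> ennreal (T a b)"
      using False unfolding T_eq
      by (auto intro!: ennreal_leI ln_mono simp: norm_minus_commute)
    finally show ?thesis .
  qed
  have "(\<integral>\<^sup>+x. truncated_kernel C (fst x) (snd x) \<partial>(\<nu> \<Otimes>\<^sub>M \<nu>)) = (\<integral>\<^sup>+z. \<integral>\<^sup>+w. truncated_kernel C z w \<partial>\<nu> \<partial>\<nu>)"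
    by (subst \<nu>.nn_integral_fst[symmetric]) auto
  also have "\<dots> = (\<integral>\<^sup>+z. (\<Sum>b\<in>A. annulus_average r (truncated_kernel C z) b) / of_nat (card A) \<partial>\<nu>)"
    unfolding \<nu>_def using A
    by (intro nn_integral_cong nn_integral_smoothed_measure) auto
  also have "\<dots> = (\<Sum>a\<in>A. annulus_average r (\<lambda>z. (\<Sum>b\<in>A. annulus_average r (truncated_kernel C z) b) / of_nat (card A)) a) / of_nat (card A)"
  proof -
    have "(\<lambda>z. \<integral>\<^sup>+w. truncated_kernel C z w \<partial>\<nu>) \<in> borel_measurable \<nu>"
      by measurable
    then have "(\<lambda>z. (\<Sum>b\<in>A. annulus_average r (truncated_kernel C z) b) / of_nat (card A)) \<in> borel_measurable borel"
      unfolding \<nu>_def using A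
      by (subst (asm) nn_integral_smoothed_measure) auto
    then show ?thesis
      unfolding \<nu>_def using A by (intro nn_integral_smoothed_measure) auto
  qed
  also have "\<dots> = (\<Sum>a\<in>A. (\<Sum>b\<in>A. annulus_average r (\<lambda>z. annulus_average r (truncated_kernel C z) b) a)
      / of_nat (card A)) / of_nat (card A)"
    by (subst annulus_average_sum_divide) (auto intro: annulus_average_truncated_kernel_measurable)
  also have "\<dots> \<le> (\<Sum>a\<in>A. (\<Sum>b\<in>A. ennreal (T a b)) / of_nat (card A)) / of_nat (card A)"
    by (intro divide_right_mono_ennreal sum_mono avg)
  also have "\<dots> = ennreal ((\<Sum>a\<in>A. (\<Sum>b\<in>A. T a b) / N) / N)"
    using N T_nonneg
    by (simp add: sum_ennreal ennreal_of_nat_eq_real_of_nat divide_ennreal sum_nonneg flip: N_def cong: sum.cong)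
  also have "(\<Sum>a\<in>A. (\<Sum>b\<in>A. T a b) / N) / N = (\<Sum>a\<in>A. \<Sum>b\<in>A. T a b) / N\<^sup>2"
    by (simp add: sum_divide_distrib power2_eq_square)
  finally have upper: "(\<integral>\<^sup>+x. truncated_kernel C (fst x) (snd x) \<partial>(\<nu> \<Otimes>\<^sub>M \<nu>)) \<le> ennreal ((\<Sum>a\<in>A. \<Sum>b\<in>A. T a b) / N\<^sup>2)" .
  \<comment> \<open>Each of the N^2 pairs carries the shift \<open>C\<close>, so division by N^2
    leaves a single \<open>C\<close>, which \<open>ereal_integral_le\<close> removes.\<close>
  have sum_T: "(\<Sum>a\<in>A. \<Sum>b\<in>A. T a b) / N\<^sup>2 = (S + N * ln (2 / r)) / N\<^sup>2 + C"
  proof -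
    have "(\<Sum>b\<in>A. T a b) = N * C + ln (2 / r) + (\<Sum>b\<in>A - {a}. ln (1 / cmod (a - b)))" if "a \<in> A" for a
    proof -
      have "(\<Sum>b\<in>A. T a b) = T a a + (\<Sum>b\<in>A - {a}. T a b)"
        using A that by (simp add: sum.remove)
      also have "(\<Sum>b\<in>A - {a}. T a b) = (\<Sum>b\<in>A - {a}. C + ln (1 / cmod (a - b)))"
        by (intro sum.cong) (auto simp: T_def)
      also have "\<dots> = (N - 1) * C + (\<Sum>b\<in>A - {a}. ln (1 / cmod (a - b)))"
        using A that by (simp add: sum.distrib N_def card_Diff_singleton of_nat_diff card_gt_0_iff Suc_leI del: ln_inverse)
      finally show ?thesis
        by (simp add: T_def algebra_simps)
    qed
    then have "(\<Sum>a\<in>A. \<Sum>b\<in>A. T a b) = N * (N * C + ln (2 / r)) + S"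
      by (simp add: sum.distrib S_def N_def algebra_simps)
    then show ?thesis
      using N by (simp add: field_simps power2_eq_square)
  qed
  have "cmod (z - w) \<le> exp C" if zw: "z \<in> (\<Union>a\<in>A. cball a r)" "w \<in> (\<Union>a\<in>A. cball a r)" for z w
  proof -
    obtain a b where ab: "a \<in> A" "b \<in> A" "z \<in> cball a r" "w \<in> cball b r"
      using zw by (auto simp del: mem_cball)
    have "cmod (z - w) \<le> cmod (z - b) + cmod (b - w)"
      using norm_triangle_ineq[of "z - b" "b - w"] by simp
    also have "\<dots> \<le> cmod (z - b) + r"
      using ab by (simp add: dist_norm)
    also have "\<dots> \<le> exp C"
      using ab near by blast
    finally show ?thesis .
  qed
  then have lower: "AE x in \<nu> \<Otimes>\<^sub>M \<nu>. - ereal C \<le> (\<lambda>(z, w). log_kernel z w) x"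
    by (intro AE_log_kernel_ge[OF \<nu>_mem])
  have kernel: "e2ennreal ((\<lambda>(z, w). log_kernel z w) x + ereal C) = truncated_kernel C (fst x) (snd x)" for x
    by (auto simp: log_kernel_def truncated_kernel_def case_prod_beta e2ennreal_ereal ln_div)
  have "log_energy \<nu> \<le> ereal ((S + N * ln (2 / r)) / N\<^sup>2)"
    unfolding log_energy_def
  proof (rule ereal_integral_le[OF _ _ lower])
    show "(\<integral>\<^sup>+x. e2ennreal ((\<lambda>(z, w). log_kernel z w) x + ereal C) \<partial>(\<nu> \<Otimes>\<^sub>M \<nu>)) \<le> ennreal ((S + N * ln (2 / r)) / N\<^sup>2 + C)"
      using upper by (simp only: kernel sum_T)
    show "0 \<le> (S + N * ln (2 / r)) / N\<^sup>2 + C"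
      unfolding sum_T[symmetric] using T_nonneg by (intro divide_nonneg_nonneg sum_nonneg) auto
  qed (unfold_locales, measurable)
  then show ?thesis
    by (simp add: \<nu>_def S_def N_def)
qed

section \<open>Capacity and monic polynomials\<close>

text \<open>The test measures are smoothed Fekete sets. For each point \<open>a\<close> of such a
  set, the monic polynomial vanishing at the other points is bounded on \<open>K\<close> by twice
  its modulus at \<open>a\<close>. The hypothesis therefore bounds this modulus from below, and the
  energy from above.\<close>

lemma robin_constant_le:
  assumes K: "infinite K" "bounded K" and r: "0 < r" "\<And>a. a \<in> K \<Longrightarrow> cball a r \<subseteq> E"
    and \<kappa>: "\<And>p M. lead_coeff p = 1 \<Longrightarrow> degree p > 0 \<Longrightarrow> 0 < M \<Longrightarrow> (\<And>z. z \<in> K \<Longrightarrow> cmod (poly p z) \<le> M) \<Longrightarrow>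
      - (ln M / real (degree p)) \<le> \<kappa>"
  shows "robin_constant E \<le> ereal \<kappa>"
proof -
  \<comment> \<open>\<open>x n\<close> is the energy bound obtained from n + 1 points: ln 2 comes
    from the near maximality and ln (2 / r) from the self-interaction. Both are divided by n + 1 and
    vanish in the limit.\<close>
  define x where "x n = (real n * \<kappa> + ln 2 + ln (2 / r)) / (real n + 1)" for n
  have "robin_constant E \<le> ereal (x n)" if n: "n \<ge> 1" for n
  proof -
    obtain A where A: "A \<subseteq> K" "finite A" "card A = n + 1"
      and fekete: "\<And>a w. a \<in> A \<Longrightarrow> w \<in> K \<Longrightarrow>
        (\<Prod>b\<in>A - {a}. cmod (w - b)) \<le> 2 * (\<Prod>b\<in>A - {a}. cmod (a - b))"
      using ex_nearly_fekete_set[OF K] by metis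
    have "A \<noteq> {}"
      using A by auto
    have card_A: "real (card A) = real n + 1"
      using A by simp
    have *: "(\<Sum>b\<in>A - {a}. ln (1 / cmod (a - b))) \<le> real n * \<kappa> + ln 2" if a: "a \<in> A" for a
    proof -
      define q where "q = (\<Prod>b\<in>A - {a}. cmod (a - b))"
      have "q > 0"
        unfolding q_def by (intro prod_pos) auto
      define p where "p = (\<Prod>b\<in>A - {a}. [:- b, 1:])"
      have p: "lead_coeff p = 1"
        by (simp add: p_def lead_coeff_prod)
      have deg: "degree p = n"
        using A a by (simp add: p_def degree_prod_eq_sum_degree)
      have "cmod (poly p z) \<le> 2 * q" if "z \<in> K" for z
        using fekete[OF a that] by (simp add: p_def q_def poly_prod norm_mult flip: prod_norm)
      then have "- (ln (2 * q) / real n) \<le> \<kappa>"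
        using \<kappa>[OF p, of "2 * q"] \<open>q > 0\<close> deg n by simp
      then have "- ln q \<le> real n * \<kappa> + ln 2"
        using n \<open>q > 0\<close> by (simp add: ln_mult field_simps)
      moreover have "ln q = (\<Sum>b\<in>A - {a}. ln (cmod (a - b)))"
        unfolding q_def using A by (intro ln_prod) auto
      moreover have "(\<Sum>b\<in>A - {a}. ln (1 / cmod (a - b))) = (\<Sum>b\<in>A - {a}. - ln (cmod (a - b)))"
        by (intro sum.cong) (auto simp: ln_div)
      ultimately show ?thesis
        by (simp add: sum_negf)
    qed
    have "robin_constant E \<le> log_energy (smoothed_measure r A)"
      unfolding robin_constant_def using A \<open>A \<noteq> {}\<close> r
      by (intro INF_lower smoothed_measure_mem) auto
    also have "\<dots> \<le> ereal (((\<Sum>a\<in>A. \<Sum>b\<in>A - {a}. ln (1 / cmod (a - b))) + real (card A) * ln (2 / r)) / (real (card A))\<^sup>2)"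
      using A \<open>A \<noteq> {}\<close> r by (intro log_energy_smoothed_measure_le)
    also have "\<dots> \<le> ereal (x n)"
    proof -
      have "(\<Sum>a\<in>A. \<Sum>b\<in>A - {a}. ln (1 / cmod (a - b))) \<le> (\<Sum>a\<in>A. real n * \<kappa> + ln 2)"
        by (intro sum_mono *)
      also have "\<dots> = (real n + 1) * (real n * \<kappa> + ln 2)"
        using A by simp
      finally have "((\<Sum>a\<in>A. \<Sum>b\<in>A - {a}. ln (1 / cmod (a - b))) + real (card A) * ln (2 / r)) / (real (card A))\<^sup>2
         \<le> ((real n + 1) * (real n * \<kappa> + ln 2) + (real n + 1) * ln (2 / r)) / (real n + 1)\<^sup>2"
        unfolding card_A by (intro divide_right_mono add_right_mono) auto
      also have "\<dots> = x n"
        by (simp add: x_def power2_eq_square flip: distrib_left)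
      finally show ?thesis
        by simp
    qed
    finally show ?thesis .
  qed
  moreover have "(\<lambda>n. ereal (x n)) \<longlonglongrightarrow> ereal \<kappa>"
    unfolding x_def by (intro tendsto_ereal) real_asymp
  ultimately show ?thesis
    by (metis LIMSEQ_le_const)
qed

lemma robin_constant_ge:
  assumes "bounded K" "lead_coeff p = 1" "degree p > 0" "\<And>z. z \<in> K \<Longrightarrow> cmod (poly p z) \<le> M" "M > 0"
  shows "ereal (- (ln M / real (degree p))) \<le> robin_constant K"
  unfolding robin_constant_def
  by (intro INF_greatest energy_lower_bound[OF _ assms(1)]) (use assms in auto)

section \<open>Sublevel sets near infinity\<close>

text \<open>The point 0 stands for infinity. As \<open>V\<close> contains the exterior of a disc, a
  + 1/w lies in \<open>V\<close> for all small nonzero w.\<close>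

lemma open_insert_zero_inverse_preimage:
  fixes a :: "'a :: {real_normed_field, heine_borel}"
  assumes "open V" "bounded (- V)"
  shows "open (insert 0 {w. w \<noteq> 0 \<and> a + inverse w \<in> V})"
proof -
  have "continuous_on (- {0}) (\<lambda>w. a + inverse w)"
    by (intro continuous_intros) auto
  then have "open (- {0} \<inter> (\<lambda>w. a + inverse w) -` V)"
    by (intro continuous_open_preimage assms) auto
  then have 1: "open {w. w \<noteq> 0 \<and> a + inverse w \<in> V}"
    by (simp add: vimage_def Int_def Compl_eq)
  obtain b where b: "b > 0" "\<And>z. z \<notin> V \<Longrightarrow> norm z \<le> b"
    using assms(2) by (auto simp: bounded_pos)
  have "ball 0 (1 / (b + norm a + 1)) \<subseteq> insert 0 {w. w \<noteq> 0 \<and> a + inverse w \<in> V}"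
  proof
    fix w :: 'a assume w: "w \<in> ball 0 (1 / (b + norm a + 1))"
    have "a + inverse w \<in> V" if "w \<noteq> 0"
    proof (rule ccontr)
      assume "a + inverse w \<notin> V"
      then have "norm (a + inverse w) \<le> b" by (rule b)
      then have "norm (inverse w) \<le> b + norm a"
        using norm_triangle_ineq4[of "a + inverse w" a] by simp
      moreover have "b + norm a + 1 < norm (inverse w)"
      proof -
        have "norm w * (b + norm a + 1) < 1"
          using w b(1) by (simp add: pos_less_divide_eq add_pos_nonneg)
        then show ?thesis
          using that by (simp add: norm_inverse norm_divide field_simps)
      qed
      ultimately show False by simp
    qed
    then show "w \<in> insert 0 {w. w \<noteq> 0 \<and> a + inverse w \<in> V}" by auto
  qed
  then have eq: "insert 0 {w. w \<noteq> 0 \<and> a + inverse w \<in> V} =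
    ball 0 (1 / (b + norm a + 1)) \<union> {w. w \<noteq> 0 \<and> a + inverse w \<in> V}"
    using b(1) by (auto simp: add_pos_nonneg)
  show ?thesis
    by (subst eq) (intro open_Un open_ball 1)
qed

text \<open>The limit at infinity makes the extended function continuous at 0, so the singularity
  there is removable.\<close>

lemma holomorphic_on_inverse_chart:
  assumes V: "open V" "bounded (- V)" and h: "h holomorphic_on V" "(h \<longlongrightarrow> l) at_infinity"
  shows "(\<lambda>w. if w = 0 then l else h (a + inverse w)) holomorphic_on
    insert 0 {w. w \<noteq> 0 \<and> a + inverse w \<in> V}" (is "?h holomorphic_on ?W")
proof -
  have W: "open ?W"
    by (intro open_insert_zero_inverse_preimage V)
  have "(\<lambda>w. a + inverse w) holomorphic_on ?W - {0}"
    by (intro holomorphic_intros) auto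
  then have "h \<circ> (\<lambda>w. a + inverse w) holomorphic_on ?W - {0}"
    using h(1) by (rule holomorphic_on_compose_gen) auto
  then have hol: "?h holomorphic_on ?W - {0}"
    by (rule holomorphic_transform) (auto simp: o_def)
  have "filterlim (\<lambda>w. a + inverse w) at_infinity (at 0)"
    by (intro tendsto_add_filterlim_at_infinity[OF tendsto_const filterlim_inverse_at_infinity])
  from filterlim_compose[OF h(2) this]
  have "((\<lambda>w. h (a + inverse w)) \<longlongrightarrow> l) (at 0)" .
  then have "(?h \<longlongrightarrow> l) (at 0)"
    by (rule Lim_transform_eventually) (simp add: eventually_at_filter)
  then have "isCont ?h 0"
    by (simp add: isCont_def)
  moreover have "isCont ?h w" if "w \<in> ?W - {0}" for w
    using holomorphic_on_imp_continuous_on[OF hol] that continuous_on_eq_continuous_at[OF open_delete[OF W]]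
    by blast
  ultimately have "isCont ?h w" if "w \<in> ?W" for w
    using that by (cases "w = 0") blast+
  then have "continuous_on ?W ?h"
    by (intro continuous_at_imp_continuous_on) blast
  then show ?thesis
    by (rule no_isolated_singularity[OF _ hol W]) simp
qed

text \<open>The finite part of the data of the theorem: \<open>U\<close> is \<open>\<Omega>\<close> without the point at infinity, and
  properness enters only through the closedness of the sets \<open>{\<bar>g\<bar> \<le> t}\<close> in the whole plane.\<close>

locale proper_at_infinity =
  fixes U :: "complex set" and g :: "complex \<Rightarrow> complex" and m :: nat and c :: complex
  assumes open_U: "open U" and holomorphic: "g holomorphic_on U"
    and bounded_compl: "bounded (- U)"
    and closed_sublevel: "\<And>t. 0 < t \<Longrightarrow> t < 1 \<Longrightarrow> closed {z \<in> U. cmod (g z) \<le> t}"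
    and m_pos: "0 < m" and c_nonzero: "c \<noteq> 0"
    and lim: "((\<lambda>z. z ^ m * g z) \<longlongrightarrow> c) at_infinity"
begin

section \<open>Geometry of the sets \<open>K t\<close>\<close>

definition K :: "real \<Rightarrow> complex set" where
  "K t = {z. z \<in> U \<longrightarrow> t \<le> cmod (g z)}"

lemma lim_zero: "(g \<longlongrightarrow> 0) at_infinity"
proof -
  have "((\<lambda>z. inverse z ^ m * (z ^ m * g z)) \<longlongrightarrow> 0 ^ m * c) at_infinity"
    by (intro tendsto_intros lim tendsto_inverse_0)
  moreover have "\<forall>\<^sub>F z in at_infinity. inverse z ^ m * (z ^ m * g z) = g z"
    unfolding eventually_at_infinity
  proof (intro exI[of _ 1] allI impI)
    fix z :: complex assume "1 \<le> cmod z"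
    then have "z \<noteq> 0" by auto
    then show "inverse z ^ m * (z ^ m * g z) = g z"
      by (simp add: power_inverse)
  qed
  ultimately have "(g \<longlongrightarrow> 0 ^ m * c) at_infinity"
    by (rule Lim_transform_eventually)
  then show ?thesis
    using m_pos by (simp add: power_0_left)
qed

lemma compact_K:
  assumes "0 < t"
  shows "compact (K t)"
proof -
  have "open (U \<inter> (\<lambda>z. cmod (g z)) -` {..<t})"
    using open_U by (intro continuous_open_preimage continuous_intros holomorphic_on_imp_continuous_on holomorphic) auto
  moreover have "- K t = U \<inter> (\<lambda>z. cmod (g z)) -` {..<t}"
    by (auto simp: K_def)
  ultimately have "closed (K t)"
    by (simp add: closed_def)
  moreover have "bounded (K t)"
  proof -
    have "\<forall>\<^sub>F z in at_infinity. cmod (g z) < t"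
      using tendstoD[OF lim_zero assms] by simp
    then obtain b where b: "\<And>z. b \<le> cmod z \<Longrightarrow> cmod (g z) < t"
      by (auto simp: eventually_at_infinity)
    have "K t \<subseteq> - U \<union> ball 0 b"
    proof
      fix z assume "z \<in> K t"
      then show "z \<in> - U \<union> ball 0 b"
        using b[of z] by (auto simp: K_def not_le[symmetric])
    qed
    then show ?thesis
      using bounded_compl by (metis bounded_Un bounded_ball bounded_subset)
  qed
  ultimately show ?thesis
    by (simp add: compact_eq_bounded_closed)
qed

text \<open>Otherwise \<open>g\<close> is entire and bounded, hence constant by Liouville, hence 0
  by its limit at infinity, which contradicts the nonzero limit \<open>c\<close>.\<close>

lemma K_nonempty:
  assumes "t < 1"
  shows "K t \<noteq> {}"
proof
  assume empty: "K t = {}"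
  have *: "z \<in> U \<and> cmod (g z) < t" for z
    using empty by (auto simp: K_def not_le dest: equals0D[of _ z])
  then have U: "U = UNIV" and less: "cmod (g z) < t" for z
    by auto
  have "g constant_on UNIV"
  proof (rule Liouville_theorem)
    show "bounded (range g)"
      using less by (auto simp: bounded_iff intro: less_imp_le)
  qed (use holomorphic U in auto)
  then obtain k where k: "g = (\<lambda>_. k)"
    by (auto simp: constant_on_def)
  then have "k = 0"
    using lim_zero by (simp add: tendsto_const_iff[OF trivial_limit_at_infinity])
  then show False
    using lim c_nonzero k by (simp add: tendsto_const_iff[OF trivial_limit_at_infinity])
qed

text \<open>The compact set \<open>K t\<close> is disjoint from the set where |g| \<le> s, which is
  closed in the whole plane by properness, so the two have positive distance. This is the room for
  smearing out points.\<close>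

lemma K_cball:
  assumes "0 < s" "s < t" "t < 1"
  obtains r where "0 < r" "\<And>a. a \<in> K t \<Longrightarrow> cball a r \<subseteq> K s"
proof -
  have "K t \<inter> {z \<in> U. cmod (g z) \<le> s} = {}"
    using assms by (auto simp: K_def)
  then obtain d where d: "d > 0" "\<And>x y. x \<in> K t \<Longrightarrow> y \<in> {z \<in> U. cmod (g z) \<le> s} \<Longrightarrow> d \<le> dist x y"
    using separate_compact_closed[OF compact_K closed_sublevel, of t s] assms by auto
  show ?thesis
  proof (rule that[of "d / 2"])
    fix a assume a: "a \<in> K t"
    show "cball a (d / 2) \<subseteq> K s"
    proof
      fix z assume "z \<in> cball a (d / 2)"
      then have "dist a z < d"
        using d(1) by simp
      then show "z \<in> K s"
        using d(2)[OF a, of z] by (fastforce simp: K_def)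
    qed
  qed (use d in auto)
qed

text \<open>A higher level t' < 1 has a nonempty \<open>K t'\<close>, and around each of its points
  a whole disc lies in \<open>K t\<close>.\<close>

lemma infinite_K:
  assumes "0 < t" "t < 1"
  shows "infinite (K t)"
proof -
  define t' where "t' = (t + 1) / 2"
  have "t < t'" "t' < 1"
    using assms by (auto simp: t'_def field_simps)
  then obtain r a where "0 < r" "cball a r \<subseteq> K t"
    using K_cball[of t t'] K_nonempty[of t'] assms by (metis all_not_in_conv)
  then show ?thesis
    by (meson finite_subset uncountable_cball uncountable_infinite)
qed

text \<open>The inversion w = 1/(z - a), with \<open>a\<close> the centre of a disc inside
  \<open>K t\<close>, maps the outside of \<open>K t\<close> to a bounded open set with infinity at
  w = 0. There the maximum modulus principle applies to p^m g^n; its value c^n at w = 0 gives the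
  second claim.\<close>

lemma maximum_principle:
  assumes t: "0 < t" "t < 1"
    and p: "lead_coeff p = 1" "degree p = n" "\<And>z. z \<in> K t \<Longrightarrow> cmod (poly p z) \<le> M"
  shows "\<And>z. z \<in> U \<Longrightarrow> cmod (g z) < t \<Longrightarrow> cmod (poly p z) ^ m * cmod (g z) ^ n \<le> M ^ m * t ^ n"
    and "cmod c ^ n \<le> M ^ m * t ^ n"
proof -
  define h where "h z = poly p z ^ m * g z ^ n" for z
  have h_hol: "h holomorphic_on U"
    unfolding h_def by (intro holomorphic_intros holomorphic)
  have h_lim: "(h \<longlongrightarrow> c ^ n) at_infinity"
  proof -
    have "((\<lambda>z. (poly p z / z ^ n) ^ m * (z ^ m * g z) ^ n) \<longlongrightarrow> 1 ^ m * c ^ n) at_infinity"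
      using poly_divide_tendsto_aux[of p] p by (intro tendsto_intros lim) auto
    moreover have "\<forall>\<^sub>F z in at_infinity. (poly p z / z ^ n) ^ m * (z ^ m * g z) ^ n = h z"
      unfolding eventually_at_infinity
      by (intro exI[of _ 1]) (auto simp: h_def power_mult_distrib power_divide mult.commute[of m] simp flip: power_mult)
    ultimately show ?thesis
      by (simp add: tendsto_cong)
  qed
  define t' where "t' = (t + 1) / 2"
  have t': "t < t'" "t' < 1"
    using t by (auto simp: t'_def field_simps)
  \<comment> \<open>The disc of radius \<open>r\<close> about \<open>a\<close> inside
    \<open>K t\<close> confines the image of the complement to the disc of radius 1/r.\<close>
  then obtain r a where r: "0 < r" "cball a r \<subseteq> K t"
    using K_cball[of t t'] K_nonempty[of t'] t by (metis all_not_in_conv)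
  define W where "W V = insert 0 {w. w \<noteq> 0 \<and> a + inverse w \<in> V}" for V
  define H where "H w = (if w = 0 then c ^ n else h (a + inverse w))" for w
  have H_hol: "H holomorphic_on W U"
    unfolding H_def W_def by (intro holomorphic_on_inverse_chart open_U bounded_compl h_hol h_lim)
  define E where "E = W (- K t)"
  have "open E"
    unfolding E_def W_def using compact_K[OF t(1)]
    by (intro open_insert_zero_inverse_preimage) (auto simp: compact_eq_bounded_closed)
  have "E \<subseteq> W U"
    by (auto simp: E_def W_def K_def)
  have "E \<subseteq> cball 0 (1 / r)"
  proof
    fix w assume w: "w \<in> E"
    show "w \<in> cball 0 (1 / r)"
    proof (cases "w = 0")
      case False
      then have "a + inverse w \<notin> cball a r"
        using w r by (auto simp: E_def W_def)
      then show ?thesis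
        using False r by (simp add: dist_norm norm_inverse norm_divide field_simps)
    qed (use r in auto)
  qed
  then have "bounded E"
    using bounded_cball bounded_subset by blast
  \<comment> \<open>A closed set between \<open>E\<close> and the domain of \<open>H\<close>: it
    ensures that \<open>H\<close> is continuous on the closure of \<open>E\<close>.\<close>
  define Z where "Z = W {z \<in> U. cmod (g z) \<le> t}"
  have "closed Z"
  proof -
    have "open (- {0} \<inter> (\<lambda>w. a + inverse w) -` (- {z \<in> U. cmod (g z) \<le> t}))"
      using closed_sublevel[OF t] by (intro continuous_open_preimage continuous_intros) auto
    moreover have "- Z = - {0} \<inter> (\<lambda>w. a + inverse w) -` (- {z \<in> U. cmod (g z) \<le> t})"
      by (auto simp: Z_def W_def)
    ultimately show ?thesis
      by (simp add: closed_def)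
  qed
  moreover have "E \<subseteq> Z"
    by (auto simp: E_def Z_def W_def K_def)
  ultimately have "closure E \<subseteq> Z"
    by (simp add: closure_minimal)
  have "Z \<subseteq> W U"
    by (auto simp: Z_def W_def)
  have bound: "cmod (H w) \<le> M ^ m * t ^ n" if "w \<in> E" for w
  proof (rule maximum_modulus_frontier[of H E])
    show "H holomorphic_on interior E"
      using \<open>E \<subseteq> W U\<close> \<open>open E\<close> by (simp add: interior_open holomorphic_on_subset[OF H_hol])
    show "continuous_on (closure E) H"
      using holomorphic_on_imp_continuous_on[OF H_hol] \<open>closure E \<subseteq> Z\<close> \<open>Z \<subseteq> W U\<close>
      by (metis continuous_on_subset)
    \<comment> \<open>A frontier point lies in \<open>Z\<close> but not in the open set
      \<open>E\<close>, so its preimage satisfies both |g| \<le> t and the bound on \<open>p\<close>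
      over \<open>K t\<close>.\<close>
    fix w assume "w \<in> frontier E"
    then have "w \<in> Z" "w \<notin> E"
      using \<open>closure E \<subseteq> Z\<close> \<open>open E\<close> by (auto simp: frontier_def interior_open)
    then have w: "w \<noteq> 0" "a + inverse w \<in> K t" "a + inverse w \<in> U" "cmod (g (a + inverse w)) \<le> t"
      by (auto simp: Z_def E_def W_def)
    moreover have "0 \<le> M"
      using p(3)[OF w(2)] norm_ge_zero order_trans by blast
    ultimately show "cmod (H w) \<le> M ^ m * t ^ n"
      using p(3)[OF w(2)] t
      by (auto simp: H_def h_def norm_mult norm_power intro!: mult_mono power_mono)
  qed (use that \<open>bounded E\<close> in auto)
  show "cmod c ^ n \<le> M ^ m * t ^ n"
    using bound[of 0] by (simp add: E_def W_def H_def norm_power)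
  fix z assume z: "z \<in> U" "cmod (g z) < t"
  moreover have "a \<in> K t"
    using r by (meson centre_in_cball less_imp_le subsetD)
  ultimately have "z \<noteq> a"
    by (auto simp: K_def)
  then have "inverse (z - a) \<in> E" "inverse (z - a) \<noteq> 0"
    using z by (auto simp: E_def W_def K_def)
  with bound[of "inverse (z - a)"]
  show "cmod (poly p z) ^ m * cmod (g z) ^ n \<le> M ^ m * t ^ n"
    by (simp add: H_def h_def norm_mult norm_power)
qed


section \<open>Robin constants of the sets \<open>K t\<close>\<close>

lemma ereal_le_ln_limit:
  assumes "0 < t" "t < 1" "\<And>t'. t < t' \<Longrightarrow> t' < 1 \<Longrightarrow> x \<le> ereal ((ln t' - b) / real m)"
  shows "x \<le> ereal ((ln t - b) / real m)"
proof -
  have "((\<lambda>t'. ereal ((ln t' - b) / real m)) \<longlongrightarrow> ereal ((ln t - b) / real m)) (at_right t)"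
    using assms(1) m_pos by (intro tendsto_intros) auto
  moreover have "\<forall>\<^sub>F t' in at_right t. x \<le> ereal ((ln t' - b) / real m)"
    using assms(2,3) by (auto simp: eventually_at_right intro!: exI[of _ 1])
  ultimately show ?thesis
    by (rule tendsto_lowerbound) simp
qed

text \<open>The value of p^m g^n at infinity gives -ln M / n \<le> (ln t' - ln |c|) / m for every
  monic \<open>p\<close> of degree n bounded by \<open>M\<close> on \<open>K t'\<close>, which is
  what the Fekete estimate asks for.\<close>

lemma robin_constant_K_le:
  assumes t: "0 < t" "t < 1"
  shows "robin_constant (K t) \<le> ereal ((ln t - ln (cmod c)) / real m)"
proof (rule ereal_le_ln_limit[OF t])
  \<comment> \<open>Fekete points are taken in the smaller set \<open>K t'\<close>, where they can
    be smeared out within \<open>K t\<close>; afterwards t' decreases to t.\<close>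
  fix t' assume t': "t < t'" "t' < 1"
  with t have "0 < t'" by simp
  obtain r where r: "0 < r" "\<And>a. a \<in> K t' \<Longrightarrow> cball a r \<subseteq> K t"
    using K_cball t t' by blast
  show "robin_constant (K t) \<le> ereal ((ln t' - ln (cmod c)) / real m)"
  proof (rule robin_constant_le[OF infinite_K compact_imp_bounded[OF compact_K] r])
    fix p :: "complex poly" and M :: real
    assume p: "lead_coeff p = 1" "0 < degree p" "0 < M" "\<And>z. z \<in> K t' \<Longrightarrow> cmod (poly p z) \<le> M"
    define n where "n = degree p"
    have "cmod c ^ n \<le> M ^ m * t' ^ n"
      by (rule maximum_principle(2)[OF \<open>0 < t'\<close> t'(2) p(1) n_def[symmetric] p(4)])
    then have "ln (cmod c ^ n) \<le> ln (M ^ m * t' ^ n)"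
      using c_nonzero by (intro ln_mono) auto
    also have "\<dots> = real m * ln M + real n * ln t'"
      using p \<open>0 < t'\<close> by (simp add: ln_mult ln_realpow)
    finally show "- (ln M / real (degree p)) \<le> (ln t' - ln (cmod c)) / real m"
      using c_nonzero p m_pos by (simp add: ln_realpow n_def field_simps)
  qed (use \<open>0 < t'\<close> t' in auto)
qed

text \<open>The preceding upper bound excludes \<infinity>, and the monic polynomial X, bounded on
  \<open>K t\<close>, excludes the value -\<infinity>.\<close>

lemma robin_constant_K_real:
  assumes t: "0 < t" "t < 1"
  obtains \<rho> where "robin_constant (K t) = ereal \<rho>"
proof -
  have "bounded (K t)"
    using compact_K t compact_imp_bounded by blast
  then obtain M where M: "0 < M" "\<And>z. z \<in> K t \<Longrightarrow> cmod z \<le> M"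
    by (auto simp: bounded_pos)
  then have "ereal (- (ln M / real (degree [:0, 1::complex:]))) \<le> robin_constant (K t)"
    using \<open>bounded (K t)\<close> by (intro robin_constant_ge) auto
  with robin_constant_K_le[OF t] show ?thesis
    by (cases "robin_constant (K t)") (auto intro: that)
qed

text \<open>A monic polynomial bounded on \<open>K t'\<close> also has a controlled bound on
  \<open>K s\<close>, so the Robin constant of \<open>K s\<close> limits how small it can be. This
  is the input of the Fekete estimate for \<open>K t\<close>.\<close>

lemma robin_constant_K_mono:
  assumes st: "0 < s" "s < t" "t < 1"
  shows "robin_constant (K t) \<le> robin_constant (K s) + ereal ((ln t - ln s) / real m)"
proof -
  obtain \<rho> where \<rho>: "robin_constant (K s) = ereal \<rho>"
    using robin_constant_K_real[of s] st by auto
  \<comment> \<open>The constant ln s - m\<rho> casts the bound \<rho> + (ln t - ln s) / m into the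
    form that permits the passage from t' to t.\<close>
  have "robin_constant (K t) \<le> ereal ((ln t - (ln s - real m * \<rho>)) / real m)"
  proof (rule ereal_le_ln_limit)
    fix t' assume t': "t < t'" "t' < 1"
    with st have "0 < t'" "s < t'" by auto
    obtain r where r: "0 < r" "\<And>a. a \<in> K t' \<Longrightarrow> cball a r \<subseteq> K t"
      using K_cball[of t t'] st t' by auto
    show "robin_constant (K t) \<le> ereal ((ln t' - (ln s - real m * \<rho>)) / real m)"
    proof (rule robin_constant_le[OF infinite_K compact_imp_bounded[OF compact_K] r])
      fix p :: "complex poly" and M :: real
      assume p: "lead_coeff p = 1" "0 < degree p" "0 < M" "\<And>z. z \<in> K t' \<Longrightarrow> cmod (poly p z) \<le> M"
      define n where "n = degree p"
      \<comment> \<open>On \<open>K s\<close> outside \<open>K t'\<close> one has |g| \<ge> s, so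
        the maximum principle yields |p|^m \<le> M^m (t'/s)^n; \<open>M'\<close> is the m-th root of
        the right-hand side.\<close>
      define M' where "M' = M * (t' / s) powr (real n / real m)"
      have "M' > 0"
        using p \<open>0 < t'\<close> st by (simp add: M'_def)
      have M'_power: "M' ^ m = M ^ m * (t' / s) ^ n"
      proof -
        have "((t' / s) powr (real n / real m)) ^ m = (t' / s) ^ n"
          using m_pos st \<open>0 < t'\<close> by (simp add: powr_powr flip: powr_realpow)
        then show ?thesis
          by (simp add: M'_def power_mult_distrib)
      qed
      have "cmod (poly p z) \<le> M'" if z: "z \<in> K s" for z
      proof (cases "z \<in> K t'")
        case True
        have "1 \<le> (t' / s) powr (real n / real m)"
          using st \<open>s < t'\<close> by (intro ge_one_powr_ge_zero) auto
        then have "M \<le> M'"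
          using p(3) by (simp add: M'_def)
        then show ?thesis
          using p(4)[OF True] by simp
      next
        case False
        then have zU: "z \<in> U" "cmod (g z) < t'" "s \<le> cmod (g z)"
          using z by (auto simp: K_def)
        have "cmod (poly p z) ^ m * s ^ n \<le> cmod (poly p z) ^ m * cmod (g z) ^ n"
          using zU st by (intro mult_left_mono power_mono) auto
        also have "\<dots> \<le> M ^ m * t' ^ n"
          by (rule maximum_principle(1)[OF \<open>0 < t'\<close> t'(2) p(1) n_def[symmetric] p(4) zU(1,2)])
        finally have "cmod (poly p z) ^ m \<le> M' ^ m"
          using st by (simp add: M'_power field_simps)
        then show ?thesis
          using m_pos \<open>M' > 0\<close> by (subst (asm) power_mono_iff) auto
      qed
      then have "ereal (- (ln M' / real n)) \<le> ereal \<rho>"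
        unfolding \<rho>[symmetric] n_def using st p \<open>M' > 0\<close>
        by (intro robin_constant_ge compact_imp_bounded[OF compact_K]) auto
      moreover have "ln M' = ln M + real n / real m * (ln t' - ln s)"
        using p st \<open>0 < t'\<close> by (simp add: M'_def ln_mult ln_powr ln_div)
      ultimately show "- (ln M / real (degree p)) \<le> (ln t' - (ln s - real m * \<rho>)) / real m"
        using p m_pos by (simp add: n_def field_simps)
    qed (use \<open>0 < t'\<close> t' in auto)
  qed (use st in auto)
  then show ?thesis
    using m_pos by (simp add: \<rho> field_simps)
qed

end

section \<open>Extremal polynomials for small sublevel sets\<close>

text \<open>On each of the n intervals of length 1/n, replacing the function by its left value loses
  at most \<epsilon>/n; the intervals are joined by induction.\<close>

lemma left_riemann_sum_le:
  fixes \<Phi> :: "real \<Rightarrow> real"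
  assumes I: "(\<Phi> has_integral I) {0..1}" and "n > 0"
    and le: "\<And>j x. j < n \<Longrightarrow> x \<in> {real j / n..real (Suc j) / n} \<Longrightarrow> \<Phi> (real j / n) \<le> \<Phi> x + \<epsilon>"
  shows "(\<Sum>j<n. \<Phi> (real j / n)) \<le> n * (I + \<epsilon>)"
proof -
  have int: "\<Phi> integrable_on {0..1}"
    using I by (rule has_integral_integrable)
  have "(\<Sum>j<k. \<Phi> (real j / n)) \<le> n * integral {0..real k / n} \<Phi> + k * \<epsilon>" if "k \<le> n" for k
    using that
  proof (induction k)
    case (Suc k)
    have sub: "\<Phi> integrable_on {0..real (Suc k) / n}" "\<Phi> integrable_on {real k / n..real (Suc k) / n}"
    proof -
      have *: "0 \<le> real k / n" "real k / n \<le> real (Suc k) / n" "real (Suc k) / n \<le> 1"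
        using Suc.prems by (auto simp: divide_right_mono)
      show "\<Phi> integrable_on {0..real (Suc k) / n}" "\<Phi> integrable_on {real k / n..real (Suc k) / n}"
        by (rule integrable_on_subinterval[OF int], subst atLeastatMost_subset_iff, use * in linarith)+
    qed
    have "integral {real k / n..real (Suc k) / n} (\<lambda>_. \<Phi> (real k / n) - \<epsilon>)
      \<le> integral {real k / n..real (Suc k) / n} \<Phi>"
      using le[of k] Suc.prems sub by (intro integral_le) (auto simp: algebra_simps)
    also have "integral {real k / n..real (Suc k) / n} (\<lambda>_. \<Phi> (real k / n) - \<epsilon>) = (\<Phi> (real k / n) - \<epsilon>) / n"
      using \<open>n > 0\<close> by (simp add: field_simps)
    finally have "\<Phi> (real k / n) \<le> n * integral {real k / n..real (Suc k) / n} \<Phi> + \<epsilon>"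
      using \<open>n > 0\<close> by (simp add: field_simps)
    moreover have "integral {0..real k / n} \<Phi> + integral {real k / n..real (Suc k) / n} \<Phi> = integral {0..real (Suc k) / n} \<Phi>"
      using sub(1) by (intro Henstock_Kurzweil_Integration.integral_combine) (auto simp: divide_right_mono)
    then have "n * integral {0..real (Suc k) / n} \<Phi> =
        n * integral {0..real k / n} \<Phi> + n * integral {real k / n..real (Suc k) / n} \<Phi>"
      by (metis distrib_left)
    ultimately show ?case
      using Suc.IH Suc.prems by (simp add: algebra_simps)
  qed simp
  from this[of n] have "(\<Sum>j<n. \<Phi> (real j / n)) \<le> n * integral {0..1} \<Phi> + n * \<epsilon>"
    using \<open>n > 0\<close> by simp
  then show ?thesis
    using I by (simp add: integral_unique algebra_simps)
qed

context proper_at_infinity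
begin

text \<open>In w = 1/z the function is w^m G(w) with G(0) = c. A holomorphic m-th root \<gamma> of G
  near 0 gives \<phi>(w) = w \<gamma>(w), whose m-th power is g(1/w) and whose derivative at 0 is
  \<gamma>(0) \<noteq> 0. Then \<eta> is the local inverse of \<phi>, and \<Gamma> is \<gamma>
  composed with \<eta>.\<close>

lemma local_coordinate:
  obtains R \<eta> \<Gamma> where "0 < R" "\<eta> holomorphic_on ball 0 R" "\<Gamma> holomorphic_on ball 0 R"
    "\<And>\<zeta>. \<zeta> \<in> ball 0 R \<Longrightarrow> \<Gamma> \<zeta> \<noteq> 0" "\<And>\<zeta>. \<zeta> \<in> ball 0 R \<Longrightarrow> \<eta> \<zeta> * \<Gamma> \<zeta> = \<zeta>"
    "cmod (\<Gamma> 0) ^ m = cmod c"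
    "\<And>\<zeta>. \<zeta> \<in> ball 0 R \<Longrightarrow> \<zeta> \<noteq> 0 \<Longrightarrow> inverse (\<eta> \<zeta>) \<in> U \<and> g (inverse (\<eta> \<zeta>)) = \<zeta> ^ m"
proof -
  define W where "W = insert 0 {w. w \<noteq> 0 \<and> 0 + inverse w \<in> U}"
  define G where "G w = (if w = 0 then c else (\<lambda>z. z ^ m * g z) (0 + inverse w))" for w
  have "open W"
    unfolding W_def by (intro open_insert_zero_inverse_preimage open_U bounded_compl)
  have G_hol: "G holomorphic_on W"
    unfolding W_def G_def
    by (intro holomorphic_on_inverse_chart open_U bounded_compl lim holomorphic_intros holomorphic)
  have "open (W \<inter> G -` (- {0}))"
    by (intro continuous_open_preimage holomorphic_on_imp_continuous_on G_hol \<open>open W\<close>) auto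
  moreover have "0 \<in> W \<inter> G -` (- {0})"
    using c_nonzero by (auto simp: W_def G_def)
  ultimately obtain r1 where r1: "r1 > 0" "ball 0 r1 \<subseteq> W \<inter> G -` (- {0})"
    by (metis openE)
  have "G holomorphic_on ball 0 r1"
    using G_hol by (rule holomorphic_on_subset) (use r1 in auto)
  moreover have "simply_connected (ball (0::complex) r1)"
    by (simp add: convex_imp_simply_connected)
  ultimately obtain L where L: "L holomorphic_on ball 0 r1" "\<And>w. w \<in> ball 0 r1 \<Longrightarrow> G w = exp (L w)"
    using simply_connected_eq_holomorphic_log[of "ball (0::complex) r1"] r1 by auto
  define \<gamma> where "\<gamma> w = exp (L w / of_nat m)" for w
  define \<phi> where "\<phi> w = w * \<gamma> w" for w
  have \<gamma>_hol: "\<gamma> holomorphic_on ball 0 r1"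
    unfolding \<gamma>_def using m_pos by (intro holomorphic_intros L) auto
  have \<phi>_hol: "\<phi> holomorphic_on ball 0 r1"
    unfolding \<phi>_def by (intro holomorphic_intros \<gamma>_hol)
  have \<gamma>_power: "\<gamma> w ^ m = G w" if "w \<in> ball 0 r1" for w
    using L(2)[OF that] m_pos by (simp add: \<gamma>_def flip: exp_of_nat_mult)
  have \<phi>_power: "\<phi> w ^ m = g (inverse w)" "inverse w \<in> U" if "w \<in> ball 0 r1" "w \<noteq> 0" for w
  proof -
    show "inverse w \<in> U"
      using that r1 by (auto simp: W_def)
    show "\<phi> w ^ m = g (inverse w)"
      using that \<gamma>_power[OF that(1)] by (simp add: \<phi>_def power_mult_distrib G_def power_inverse)
  qed
  have "\<gamma> field_differentiable at 0"
    using \<gamma>_hol r1 by (intro holomorphic_on_imp_differentiable_at[of _ "ball 0 r1"]) auto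
  then obtain D where "(\<gamma> has_field_derivative D) (at 0)"
    by (auto simp: field_differentiable_def)
  then have "(\<phi> has_field_derivative (1 * \<gamma> 0 + D * 0)) (at 0)"
    unfolding \<phi>_def by (intro DERIV_mult DERIV_ident)
  then have "deriv \<phi> 0 \<noteq> 0"
    by (simp add: DERIV_imp_deriv \<gamma>_def)
  have "0 \<in> ball (0::complex) r1"
    using r1 by simp
  obtain r2 where r2: "r2 > 0" "ball 0 r2 \<subseteq> ball (0::complex) r1" "open (\<phi> ` ball 0 r2)" "inj_on \<phi> (ball 0 r2)"
    by (rule has_complex_derivative_locally_invertible[OF \<phi>_hol \<open>0 \<in> ball 0 r1\<close> open_ball \<open>deriv \<phi> 0 \<noteq> 0\<close>]) (rule that)
  obtain \<eta> where \<eta>: "\<eta> holomorphic_on (\<phi> ` ball 0 r2)" "\<And>w. w \<in> ball 0 r2 \<Longrightarrow> \<eta> (\<phi> w) = w"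
    using holomorphic_has_inverse[OF holomorphic_on_subset[OF \<phi>_hol r2(2)] open_ball r2(4)] by metis
  have "0 \<in> \<phi> ` ball 0 r2"
    using r2 by (intro image_eqI[of _ _ 0]) (auto simp: \<phi>_def)
  then obtain R where R: "R > 0" "ball 0 R \<subseteq> \<phi> ` ball 0 r2"
    using r2(3) by (metis openE)
  have inv: "\<eta> \<zeta> \<in> ball 0 r2" "\<phi> (\<eta> \<zeta>) = \<zeta>" if "\<zeta> \<in> ball 0 R" for \<zeta>
    using that R \<eta>(2) by force+
  have \<eta>_hol: "\<eta> holomorphic_on ball 0 R"
    using \<eta>(1) R(2) by (rule holomorphic_on_subset)
  show ?thesis
  proof (rule that[of R \<eta> "\<lambda>\<zeta>. \<gamma> (\<eta> \<zeta>)"])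
    show "(\<lambda>\<zeta>. \<gamma> (\<eta> \<zeta>)) holomorphic_on ball 0 R"
    proof -
      have "\<eta> ` ball 0 R \<subseteq> ball 0 r1"
        using inv(1) r2(2) by blast
      then show ?thesis
        using holomorphic_on_compose_gen[OF \<eta>_hol \<gamma>_hol] by (simp add: o_def)
    qed
    show "\<gamma> (\<eta> \<zeta>) \<noteq> 0" for \<zeta>
      by (simp add: \<gamma>_def)
    show "\<eta> \<zeta> * \<gamma> (\<eta> \<zeta>) = \<zeta>" if "\<zeta> \<in> ball 0 R" for \<zeta>
      using inv(2)[OF that] by (simp add: \<phi>_def)
    have "\<eta> 0 = 0"
      using \<eta>(2)[of 0] r2 by (simp add: \<phi>_def)
    then show "cmod (\<gamma> (\<eta> 0)) ^ m = cmod c"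
      using \<gamma>_power[of 0] r1 by (simp add: G_def flip: norm_power)
    show "inverse (\<eta> \<zeta>) \<in> U \<and> g (inverse (\<eta> \<zeta>)) = \<zeta> ^ m" if "\<zeta> \<in> ball 0 R" "\<zeta> \<noteq> 0" for \<zeta>
    proof -
      have "\<eta> \<zeta> \<noteq> 0"
        using inv(2)[OF that(1)] that(2) by (auto simp: \<phi>_def)
      then show ?thesis
        using \<phi>_power[of "\<eta> \<zeta>"] inv[OF that(1)] r2(2) by auto
    qed
  qed (use R \<eta>_hol in auto)
qed

text \<open>Place zeros at 1/\<eta>(\<zeta>) for n equally spaced \<zeta> on a circle of radius
  slightly below t^(1/m). For w in \<open>K t\<close>, ln |p(w)| is, up to an explicit term, a
  Riemann sum for a circle mean of ln |N|. That mean is the same for all w, since \<open>N w\<close>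
  has no zero in the disc and \<open>N w 0\<close> does not depend on w.\<close>

lemma robin_constant_K_ge:
  obtains t\<^sub>1 where "0 < t\<^sub>1" "t\<^sub>1 < 1"
    "\<And>t. 0 < t \<Longrightarrow> t < t\<^sub>1 \<Longrightarrow> ereal ((ln t - ln (cmod c)) / real m) \<le> robin_constant (K t)"
proof -
  obtain R \<eta> \<Gamma> where R: "0 < R" and hol: "\<eta> holomorphic_on ball 0 R" "\<Gamma> holomorphic_on ball 0 R"
    and \<Gamma>: "\<And>\<zeta>. \<zeta> \<in> ball 0 R \<Longrightarrow> \<Gamma> \<zeta> \<noteq> 0" and \<eta>\<Gamma>: "\<And>\<zeta>. \<zeta> \<in> ball 0 R \<Longrightarrow> \<eta> \<zeta> * \<Gamma> \<zeta> = \<zeta>"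
    and \<Gamma>0: "cmod (\<Gamma> 0) ^ m = cmod c"
    and g_\<eta>: "\<And>\<zeta>. \<zeta> \<in> ball 0 R \<Longrightarrow> \<zeta> \<noteq> 0 \<Longrightarrow> inverse (\<eta> \<zeta>) \<in> U \<and> g (inverse (\<eta> \<zeta>)) = \<zeta> ^ m"
    by (rule local_coordinate) blast
  define \<gamma> where "\<gamma> = cmod (\<Gamma> 0)"
  have \<gamma>: "\<gamma> > 0" "ln (cmod c) = real m * ln \<gamma>"
    using \<Gamma>[of 0] R by (auto simp: \<gamma>_def ln_realpow simp flip: \<Gamma>0)
  \<comment> \<open>The bound R^m makes \<rho> = t^(1/m) smaller than \<open>R\<close>; the bound
    1/2 keeps the threshold below 1.\<close>
  define t\<^sub>1 where "t\<^sub>1 = min (R ^ m) (1 / 2)"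
  have "ereal ((ln t - ln (cmod c)) / real m) \<le> robin_constant (K t)" if t: "0 < t" "t < t\<^sub>1" for t
  proof -
    define \<rho> where "\<rho> = t powr (1 / real m)"
    have \<rho>_pos: "0 < \<rho>"
      using t by (simp add: \<rho>_def)
    have \<rho>_power: "\<rho> ^ m = t"
      using t m_pos \<rho>_pos by (simp add: \<rho>_def powr_powr flip: powr_realpow)
    have "\<rho> < R"
    proof (rule ccontr)
      assume "\<not> \<rho> < R"
      then have "R ^ m \<le> \<rho> ^ m"
        using R by (intro power_mono) auto
      then show False
        using t by (simp add: \<rho>_power t\<^sub>1_def)
    qed
    have ln_\<rho>: "ln \<rho> = ln t / real m"
      using t by (simp add: \<rho>_def ln_powr)
    \<comment> \<open>Up to sign, \<open>N w \<zeta>\<close> is \<zeta> times the linear factor w -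
      1/\<eta>(\<zeta>), which removes the pole at \<zeta> = 0. A zero would mean w =
      1/\<eta>(\<zeta>), hence |g(w)| = |\<zeta>|^m < t, which is impossible for w in
      \<open>K t\<close>.\<close>
    define N where "N w \<zeta> = \<Gamma> \<zeta> * (1 - w * \<eta> \<zeta>)" for w \<zeta>
    have N_nz: "N w \<zeta> \<noteq> 0" if w: "w \<in> K t" and \<zeta>: "\<zeta> \<in> ball 0 \<rho>" for w \<zeta>
    proof
      assume "N w \<zeta> = 0"
      have \<zeta>R: "\<zeta> \<in> ball 0 R"
        using \<zeta> \<open>\<rho> < R\<close> by auto
      with \<open>N w \<zeta> = 0\<close> have "w * \<eta> \<zeta> = 1"
        using \<Gamma> by (simp add: N_def)
      then have "\<eta> \<zeta> \<noteq> 0" "w = inverse (\<eta> \<zeta>)"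
        using inverse_unique[of "\<eta> \<zeta>" w] by (auto simp: mult.commute)
      moreover from this have "\<zeta> \<noteq> 0"
        using \<eta>\<Gamma>[OF \<zeta>R] \<Gamma>[OF \<zeta>R] by auto
      ultimately have "w \<in> U" "g w = \<zeta> ^ m"
        using g_\<eta>[OF \<zeta>R] by auto
      moreover have "cmod \<zeta> ^ m < \<rho> ^ m"
        using \<zeta> m_pos by (intro power_strict_mono) auto
      ultimately show False
        using w by (simp add: K_def norm_power \<rho>_power)
    qed
    have N_hol: "N w holomorphic_on ball 0 \<rho>" for w
      unfolding N_def using \<open>\<rho> < R\<close>
      by (intro holomorphic_intros holomorphic_on_subset[OF hol(1)] holomorphic_on_subset[OF hol(2)]) auto
    have bound: "ereal (ln \<rho>' - ln \<gamma> - \<epsilon>) \<le> robin_constant (K t)" if \<rho>': "0 < \<rho>'" "\<rho>' < \<rho>" and \<epsilon>: "0 < \<epsilon>" for \<rho>' \<epsilon>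
    proof -
      define e where "e x = of_real \<rho>' * cis (2 * pi * x)" for x
      have e: "e x \<in> ball 0 \<rho>" "e x \<in> ball 0 R" "cmod (e x) = \<rho>'" for x
        using \<rho>' \<open>\<rho> < R\<close> by (auto simp: e_def norm_mult)
      define \<Phi> where "\<Phi> w x = ln (cmod (N w (e x)))" for w x
      have \<Phi>_int: "(\<Phi> w has_integral ln \<gamma>) {0..1}" if "w \<in> K t" for w
      proof -
        have "\<eta> 0 = 0"
          using \<eta>\<Gamma>[of 0] \<Gamma>[of 0] R by auto
        then have "N w 0 = \<Gamma> 0"
          by (simp add: N_def)
        then show ?thesis
          using has_integral_ln_norm_circle[OF N_hol N_nz[OF that] \<rho>'] by (simp add: \<Phi>_def[abs_def] \<gamma>_def e_def)
      qed
      have "continuous_on (K t \<times> {0..1}) (\<lambda>p. \<Phi> (fst p) (snd p))"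
      proof -
        have e_cont: "continuous_on (K t \<times> {0..1}) (\<lambda>p. e (snd p))"
          unfolding e_def by (intro continuous_intros)
        have "continuous_on (K t \<times> {0..1}) (\<lambda>p. \<eta> (e (snd p)))" "continuous_on (K t \<times> {0..1}) (\<lambda>p. \<Gamma> (e (snd p)))"
          using e by (auto intro!: continuous_on_compose2[OF holomorphic_on_imp_continuous_on[OF hol(1)] e_cont]
            continuous_on_compose2[OF holomorphic_on_imp_continuous_on[OF hol(2)] e_cont])
        moreover have "\<Gamma> (e (snd p)) * (1 - fst p * \<eta> (e (snd p))) \<noteq> 0" if "p \<in> K t \<times> {0..1}" for p
          using N_nz[of "fst p" "e (snd p)"] e that by (auto simp: N_def)
        ultimately show ?thesis
          unfolding \<Phi>_def N_def by (intro continuous_intros) auto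
      qed
      moreover have "compact (K t \<times> {0..1::real})"
        using compact_K t by (intro compact_Times) auto
      \<comment> \<open>Uniformity over the compact \<open>K t\<close> allows one mesh size 1/n,
        hence one polynomial, for all w at once.\<close>
      ultimately have "uniformly_continuous_on (K t \<times> {0..1}) (\<lambda>p. \<Phi> (fst p) (snd p))"
        by (rule compact_uniformly_continuous)
      then obtain \<delta> where \<delta>: "\<delta> > 0" "\<And>p q. p \<in> K t \<times> {0..1} \<Longrightarrow> q \<in> K t \<times> {0..1} \<Longrightarrow> dist q p < \<delta> \<Longrightarrow>
          dist (\<Phi> (fst q) (snd q)) (\<Phi> (fst p) (snd p)) < \<epsilon>"
        using \<epsilon> unfolding uniformly_continuous_on_def by metis
      obtain n where n: "n > 0" "1 / real n < \<delta>"
        using \<delta>(1) by (metis inverse_eq_divide ex_inverse_of_nat_less)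
      define p where "p = (\<Prod>j<n. [:- inverse (\<eta> (e (real j / n))), 1:])"
      have lead: "lead_coeff p = 1"
        by (simp add: p_def lead_coeff_prod)
      have deg: "degree p = n"
        by (simp add: p_def degree_prod_eq_sum_degree)
      have bnd: "cmod (poly p w) \<le> exp (n * (ln \<gamma> - ln \<rho>' + \<epsilon>))" if w: "w \<in> K t" for w
      proof -
        have factor: "cmod (w - inverse (\<eta> (e x))) = exp (\<Phi> w x - ln \<rho>')" for x
        proof -
          have \<eta>_nz: "\<eta> (e x) \<noteq> 0"
            using \<eta>\<Gamma>[OF e(2)[of x]] e(3)[of x] \<rho>' by auto
          have "w - inverse (\<eta> (e x)) = - N w (e x) / (\<eta> (e x) * \<Gamma> (e x))"
            using \<Gamma>[OF e(2)[of x]] \<eta>_nz by (simp add: N_def field_simps)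
          then have "w - inverse (\<eta> (e x)) = - N w (e x) / e x"
            by (simp only: \<eta>\<Gamma>[OF e(2)[of x]])
          then show ?thesis
            using N_nz[OF w e(1)[of x]] e(3)[of x] \<rho>' by (simp add: norm_divide \<Phi>_def exp_diff)
        qed
        have "cmod (poly p w) = (\<Prod>j<n. cmod (w - inverse (\<eta> (e (real j / n)))))"
          by (simp add: p_def poly_prod flip: prod_norm)
        also have "\<dots> = exp ((\<Sum>j<n. \<Phi> w (real j / n)) - n * ln \<rho>')"
          unfolding factor by (simp add: sum_subtractf flip: exp_sum)
        also have "\<dots> \<le> exp (n * (ln \<gamma> + \<epsilon>) - n * ln \<rho>')"
        proof -
          have "(\<Sum>j<n. \<Phi> w (real j / n)) \<le> n * (ln \<gamma> + \<epsilon>)"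
          proof (rule left_riemann_sum_le[OF \<Phi>_int[OF w] n(1)])
            fix j x assume j: "j < n" "x \<in> {real j / n..real (Suc j) / n}"
            have "\<bar>real j / n - x\<bar> \<le> 1 / n"
              using j(2) by (auto simp: add_divide_distrib)
            moreover have "0 \<le> real j / n" "real (Suc j) / n \<le> 1"
              using j by simp_all
            then have "x \<in> {0..1}"
              using j(2) unfolding atLeastAtMost_iff by linarith
            ultimately show "\<Phi> w (real j / n) \<le> \<Phi> w x + \<epsilon>"
              using \<delta>(2)[of "(w, x)" "(w, real j / n)"] w j n(2)
              by (auto simp: dist_Pair_Pair dist_real_def)
          qed
          then show ?thesis by simp
        qed
        finally show ?thesis
          by (simp add: algebra_simps)
      qed
      have "bounded (K t)"
        using compact_K t compact_imp_bounded by blast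
      then have "ereal (- (ln (exp (n * (ln \<gamma> - ln \<rho>' + \<epsilon>))) / real (degree p))) \<le> robin_constant (K t)"
        using n deg lead bnd by (intro robin_constant_ge) auto
      then show ?thesis
        using n by (simp add: deg)
    qed
    \<comment> \<open>A single parameter s drives both errors to 0: the radius is \<rho> - s and the
      tolerance is s.\<close>
    have "((\<lambda>s. ereal (ln (\<rho> - s) - ln \<gamma> - s)) \<longlongrightarrow> ereal (ln (\<rho> - 0) - ln \<gamma> - 0)) (at_right 0)"
      using \<rho>_pos by (intro tendsto_intros) auto
    moreover have "\<forall>\<^sub>F s in at_right 0. ereal (ln (\<rho> - s) - ln \<gamma> - s) \<le> robin_constant (K t)"
      using bound \<rho>_pos by (auto simp: eventually_at_right intro!: exI[of _ \<rho>])
    ultimately have "ereal (ln (\<rho> - 0) - ln \<gamma> - 0) \<le> robin_constant (K t)"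
      by (rule tendsto_upperbound) simp
    then show ?thesis
      using m_pos by (simp add: ln_\<rho> \<gamma>(2) diff_divide_distrib)
  qed
  then show ?thesis
    using R by (intro that[of t\<^sub>1]) (auto simp: t\<^sub>1_def)
qed

end

section \<open>Functions on the Riemann sphere\<close>

lemma topspace_riemann_sphere [simp]: "topspace riemann_sphere = UNIV"
  by (simp add: riemann_sphere_def UNIV_option_conv)

lemma Hausdorff_space_riemann_sphere: "Hausdorff_space riemann_sphere"
  by (simp add: riemann_sphere_def Hausdorff_space_Alexandroff_compactification locally_compact_space_euclidean)

lemma openin_riemann_sphere_None:
  assumes "None \<in> V"
  shows "openin riemann_sphere V \<longleftrightarrow> compact (- (Some -` V))"
proof
  assume "openin riemann_sphere V"
  with assms obtain C where "compact C" "V = insert None (Some ` (- C))"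
    by (auto simp: riemann_sphere_def openin_Alexandroff_compactification Compl_eq_Diff_UNIV)
  moreover from this have "- (Some -` V) = C"
    by auto
  ultimately show "compact (- (Some -` V))"
    by simp
next
  assume C: "compact (- (Some -` V))"
  have "V = insert None (Some ` (- (- (Some -` V))))"
    using assms by (auto simp: image_iff)
  then show "openin riemann_sphere V"
    using C compact_imp_closed[OF C]
    by (auto simp: riemann_sphere_def openin_Alexandroff_compactification Compl_eq_Diff_UNIV
        intro!: exI[of _ "- (Some -` V)"])
qed

lemma open_vimage_Some:
  assumes "openin riemann_sphere V"
  shows "open (Some -` V)"
proof -
  have "openin euclidean {x \<in> topspace euclidean. Some x \<in> V}"
    using assms unfolding riemann_sphere_def
    by (intro openin_continuous_map_preimage[OF continuous_map_Some])
  then show ?thesis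
    by (simp add: vimage_def)
qed

lemma openin_riemann_sphere_image_Some: "openin riemann_sphere (Some ` V) \<longleftrightarrow> open V"
  by (simp add: riemann_sphere_def)

text \<open>The identity theorem, run on the sphere because connectedness is given for \<Omega>
  itself. The interior \<open>A\<close> of the zero set, with infinity adjoined, and the rest of the
  finite part are disjoint open sets covering \<Omega>.\<close>

lemma sphere_domain_vanish_identically:
  assumes dom: "sphere_domain \<Omega>" "None \<in> \<Omega>" and hol: "(f \<circ> Some) holomorphic_on (Some -` \<Omega>)"
    and R: "\<And>z. R < cmod z \<Longrightarrow> Some z \<in> \<Omega> \<and> f (Some z) = 0"
    and "Some u \<in> \<Omega>"
  shows "f (Some u) = 0"
proof -
  define U where "U = Some -` \<Omega>"
  have "open U"
    using dom open_vimage_Some by (auto simp: U_def sphere_domain_def)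
  define A where "A = {z \<in> U. \<exists>e>0. ball z e \<subseteq> {w \<in> U. f (Some w) = 0}}"
  have A_zero: "f (Some x) = 0" if x: "x \<in> A" for x
  proof -
    obtain e where "e > 0" "ball x e \<subseteq> {w \<in> U. f (Some w) = 0}"
      using x by (auto simp: A_def)
    then show ?thesis
      using centre_in_ball[of x e] by blast
  qed
  have "open A"
  proof (subst open_contains_ball, intro ballI)
    fix z assume "z \<in> A"
    then obtain e where e: "e > 0" "ball z e \<subseteq> {w \<in> U. f (Some w) = 0}"
      by (auto simp: A_def)
    have "ball z e \<subseteq> A"
    proof
      fix w assume w: "w \<in> ball z e"
      then obtain d where "d > 0" "ball w d \<subseteq> ball z e"
        using open_ball openE by blast
      then show "w \<in> A"
        using e w by (auto simp: A_def)
    qed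
    then show "\<exists>e>0. ball z e \<subseteq> A"
      using e(1) by blast
  qed
  have vanish: "- cball 0 R \<subseteq> {w \<in> U. f (Some w) = 0}"
    using R by (auto simp: U_def not_le)
  have far: "- cball 0 R \<subseteq> A"
  proof
    fix z :: complex assume "z \<in> - cball 0 R"
    then obtain e where "e > 0" "ball z e \<subseteq> - cball 0 R"
      by (meson closed_cball open_Compl openE)
    moreover have "z \<in> U"
      using vanish \<open>z \<in> - cball 0 R\<close> by blast
    ultimately show "z \<in> A"
      using vanish unfolding A_def by blast
  qed
  \<comment> \<open>A disc in \<open>U\<close> that meets the open set \<open>A\<close> consists of
    zeros by analytic continuation, so its centre would lie in \<open>A\<close>.\<close>
  have "open (U - A)"
  proof (subst open_contains_ball, intro ballI)
    fix z assume z: "z \<in> U - A"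
    then obtain e where e: "e > 0" "ball z e \<subseteq> U"
      using \<open>open U\<close> by (meson DiffD1 openE)
    have "w \<notin> A" if w: "w \<in> ball z e" for w
    proof
      assume "w \<in> A"
      then have ne: "A \<inter> ball z e \<noteq> {}"
        using w by auto
      have op: "open (A \<inter> ball z e)"
        using \<open>open A\<close> by auto
      have "(f \<circ> Some) holomorphic_on ball z e"
        using hol e(2) unfolding U_def by (rule holomorphic_on_subset)
      then have "(f \<circ> Some) x = 0" if "x \<in> ball z e" for x
        by (rule analytic_continuation_open[OF op open_ball ne connected_ball Int_lower2 _ holomorphic_on_const _ that])
          (auto intro: A_zero)
      then have "ball z e \<subseteq> {w \<in> U. f (Some w) = 0}"
        using e(2) by auto
      then have "z \<in> A"
        using z e(1) by (auto simp: A_def)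
      then show False
        using z by simp
    qed
    then show "\<exists>e>0. ball z e \<subseteq> U - A"
      using e by blast
  qed
  have 1: "openin riemann_sphere (insert None (Some ` A))"
  proof (subst openin_riemann_sphere_None)
    have "- A \<subseteq> cball 0 R"
      using far by auto
    then have "bounded (- A)"
      using bounded_cball bounded_subset by blast
    then have "compact (- A)"
      using \<open>open A\<close> by (simp add: compact_eq_bounded_closed closed_def)
    moreover have "Some -` insert None (Some ` A) = A"
      by auto
    ultimately show "compact (- (Some -` insert None (Some ` A)))"
      by simp
  qed simp
  have 2: "openin riemann_sphere (Some ` (U - A))"
    using \<open>open (U - A)\<close> by (simp add: openin_riemann_sphere_image_Some)
  have "\<Omega> \<subseteq> insert None (Some ` A) \<union> Some ` (U - A)"
  proof
    fix x assume "x \<in> \<Omega>"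
    then show "x \<in> insert None (Some ` A) \<union> Some ` (U - A)"
      by (cases x) (auto simp: U_def)
  qed
  moreover have "insert None (Some ` A) \<inter> Some ` (U - A) \<inter> \<Omega> = {}"
    by auto
  moreover have "insert None (Some ` A) \<inter> \<Omega> \<noteq> {}"
    using dom by auto
  moreover have "connectedin riemann_sphere \<Omega>"
    using dom by (simp add: sphere_domain_def)
  ultimately have "Some ` (U - A) \<inter> \<Omega> = {}"
    using 1 2 unfolding connectedin by blast
  moreover have "Some ` (U - A) \<subseteq> \<Omega>"
    by (auto simp: U_def)
  ultimately have "U \<subseteq> A"
    by auto
  then show ?thesis
    using \<open>Some u \<in> \<Omega>\<close> A_zero by (auto simp: U_def)
qed

text \<open>By the identity theorem a non-constant \<open>f\<close> does not vanish identically near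
  infinity. In the chart w = 1/z it therefore factors as w^m h(w) with h(0) \<noteq> 0, so z^m f(z)
  = h(1/z) tends to h(0).\<close>

lemma leading_coeff_infinity:
  assumes dom: "sphere_domain \<Omega>" "None \<in> \<Omega>" and hol: "sphere_holomorphic_on f \<Omega>"
    and nonconst: "\<not> f constant_on \<Omega>" and zero: "f None = 0"
  shows "0 < zero_multiplicity_infinity f" "leading_coeff_infinity f \<noteq> 0"
    "((\<lambda>z. z ^ zero_multiplicity_infinity f * f (Some z)) \<longlongrightarrow> leading_coeff_infinity f) at_infinity"
proof -
  define U where "U = Some -` \<Omega>"
  define F where "F = f \<circ> infinity_chart"
  have \<Omega>: "openin riemann_sphere \<Omega>"
    using dom by (simp add: sphere_domain_def)
  then have "open U" "bounded (- U)"
    using open_vimage_Some openin_riemann_sphere_None[OF dom(2)] compact_imp_bounded by (auto simp: U_def)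
  then have "open (insert 0 {w. w \<noteq> 0 \<and> 0 + inverse w \<in> U})"
    by (rule open_insert_zero_inverse_preimage)
  also have "insert 0 {w. w \<noteq> 0 \<and> 0 + inverse w \<in> U} = infinity_chart -` \<Omega>"
    using dom(2) by (auto simp: infinity_chart_def U_def split: if_splits)
  finally have open_chart: "open (infinity_chart -` \<Omega>)" .
  moreover have "0 \<in> infinity_chart -` \<Omega>"
    using dom(2) by (simp add: infinity_chart_def)
  ultimately obtain r where r: "r > 0" "ball 0 r \<subseteq> infinity_chart -` \<Omega>"
    by (meson openE)
  have F_hol: "F holomorphic_on ball 0 r"
    using hol r(2) unfolding F_def sphere_holomorphic_on_def by (blast intro: holomorphic_on_subset)
  have "\<exists>w\<in>ball 0 r. F w \<noteq> 0"
  proof (rule ccontr)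
    assume zero_F: "\<not> ?thesis"
    have "f (Some z) = 0" if "Some z \<in> \<Omega>" for z
    proof (rule sphere_domain_vanish_identically[OF dom _ _ that])
      show "(f \<circ> Some) holomorphic_on Some -` \<Omega>"
        using hol by (simp add: sphere_holomorphic_on_def)
      fix z assume z: "1 / r < cmod z"
      then have "z \<noteq> 0"
        using r(1) by auto
      moreover have "inverse z \<in> ball 0 r"
        using z r(1) \<open>z \<noteq> 0\<close> by (simp add: norm_inverse norm_divide field_simps)
      ultimately show "Some z \<in> \<Omega> \<and> f (Some z) = 0"
        using zero_F r(2) by (force simp: F_def infinity_chart_def)
    qed
    then have "f x = 0" if "x \<in> \<Omega>" for x
      using that zero by (cases x) auto
    then show False
      using nonconst by (auto simp: constant_on_def)
  qed
  moreover have F0: "F 0 = 0"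
    using zero by (simp add: F_def infinity_chart_def)
  ultimately obtain r' where order: "0 < zorder F 0"
    and r': "r' > 0" "zor_poly F 0 holomorphic_on cball 0 r'"
      "\<And>w. w \<in> cball 0 r' \<Longrightarrow> F w = zor_poly F 0 w * (w - 0) ^ nat (zorder F 0) \<and> zor_poly F 0 w \<noteq> 0"
    using zorder_exist_zero[OF F_hol open_ball connected_ball, of 0] r(1) by auto
  define h where "h = zor_poly F 0"
  define m where "m = nat (zorder F 0)"
  have m: "zero_multiplicity_infinity f = m"
    by (simp add: zero_multiplicity_infinity_def m_def F_def)
  have "((\<lambda>z. h (inverse z)) \<longlongrightarrow> h 0) at_infinity"
  proof (rule isCont_tendsto_compose[OF _ tendsto_inverse_0])
    show "isCont h 0"
      using r'(1) holomorphic_on_imp_continuous_on[OF r'(2)]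
      by (intro continuous_on_interior[of "cball 0 r'"]) (auto simp: h_def)
  qed
  moreover have "\<forall>\<^sub>F z in at_infinity. h (inverse z) = z ^ m * f (Some z)"
    unfolding eventually_at_infinity
  proof (intro exI[of _ "1 / r'"] allI impI)
    fix z assume z: "1 / r' \<le> cmod z"
    then have "z \<noteq> 0"
      using r'(1) by auto
    moreover have "inverse z \<in> cball 0 r'"
      using z r'(1) \<open>z \<noteq> 0\<close> by (simp add: norm_inverse norm_divide field_simps)
    from r'(3)[OF this] have "f (Some z) = h (inverse z) * inverse z ^ m"
      using \<open>z \<noteq> 0\<close> by (simp add: F_def infinity_chart_def h_def m_def)
    ultimately show "h (inverse z) = z ^ m * f (Some z)"
      by (simp add: power_inverse)
  qed
  ultimately have lim: "((\<lambda>z. z ^ m * f (Some z)) \<longlongrightarrow> h 0) at_infinity"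
    by (rule Lim_transform_eventually)
  then have "leading_coeff_infinity f = h 0"
    unfolding leading_coeff_infinity_def m by (rule tendsto_Lim[OF trivial_limit_at_infinity])
  then show "0 < zero_multiplicity_infinity f" "leading_coeff_infinity f \<noteq> 0"
    "((\<lambda>z. z ^ zero_multiplicity_infinity f * f (Some z)) \<longlongrightarrow> leading_coeff_infinity f) at_infinity"
    using lim r'(1) r'(3)[of 0] order by (auto simp: m h_def m_def)
qed

text \<open>The closed disc of radius t is compact in the open unit disc, so its preimage is compact
  in the sphere, and closed there because the sphere is Hausdorff.\<close>

lemma closed_vimage_Some_sublevel:
  assumes \<Omega>: "None \<in> \<Omega>" "f None = 0" and t: "0 < t" "t < 1"
    and proper: "compact_preimage_map (subtopology riemann_sphere \<Omega>) (subtopology euclidean (ball 0 1)) f"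
  shows "closed {z \<in> Some -` \<Omega>. cmod (f (Some z)) \<le> t}"
proof -
  have "compactin (subtopology euclidean (ball 0 1)) (cball (0::complex) t)"
    using t by (auto simp: compactin_subtopology)
  then have "compactin (subtopology riemann_sphere \<Omega>) {x \<in> \<Omega>. f x \<in> cball 0 t}"
    using proper by (auto simp: compact_preimage_map_def)
  then have "closedin riemann_sphere {x \<in> \<Omega>. f x \<in> cball 0 t}"
    using Hausdorff_space_riemann_sphere compactin_imp_closedin by (auto simp: compactin_subtopology)
  then have "open (Some -` (UNIV - {x \<in> \<Omega>. f x \<in> cball 0 t}))"
    by (intro open_vimage_Some) (auto simp: closedin_def)
  moreover have "Some -` (UNIV - {x \<in> \<Omega>. f x \<in> cball 0 t}) = - {z \<in> Some -` \<Omega>. cmod (f (Some z)) \<le> t}"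
    by auto
  ultimately show ?thesis
    by (simp add: closed_def)
qed

theorem theorem4p2:
  fixes f :: "complex option \<Rightarrow> complex" and \<Omega> :: "complex option set"
  assumes "sphere_domain \<Omega>"
    and "None \<in> \<Omega>"
    and "sphere_holomorphic_on f \<Omega>"
    and "compact_preimage_map (subtopology riemann_sphere \<Omega>)
           (subtopology euclidean (ball 0 1)) f"
    and "\<not> f constant_on \<Omega>"
    and "f None = 0"
  shows "mono_on {0<..<1} (normalized_capacity f \<Omega>) \<and>
         (\<exists>t\<^sub>1\<in>{0<..<1}. \<forall>t\<in>{0<..<t\<^sub>1}.
            normalized_capacity f \<Omega> t =
              cmod (leading_coeff_infinity f) powr (1 / real (zero_multiplicity_infinity f)))"
proof -
  define m where "m = zero_multiplicity_infinity f"
  define c where "c = leading_coeff_infinity f"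
  note lead = leading_coeff_infinity[OF assms(1-3,5,6), folded m_def c_def]
  have \<Omega>: "openin riemann_sphere \<Omega>"
    using assms(1) by (simp add: sphere_domain_def)
  interpret proper_at_infinity "Some -` \<Omega>" "\<lambda>z. f (Some z)" m c
  proof
    show "open (Some -` \<Omega>)"
      using \<Omega> by (rule open_vimage_Some)
    show "bounded (- Some -` \<Omega>)"
      using \<Omega> openin_riemann_sphere_None[OF assms(2)] compact_imp_bounded by blast
    show "(\<lambda>z. f (Some z)) holomorphic_on Some -` \<Omega>"
      using assms(3) by (simp add: sphere_holomorphic_on_def o_def)
    show "closed {z \<in> Some -` \<Omega>. cmod (f (Some z)) \<le> t}" if "0 < t" "t < 1" for t
      using that assms by (intro closed_vimage_Some_sublevel)
  qed (use lead in auto)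
  have K_eq: "sublevel_complement f \<Omega> t = K t" for t
    by (auto simp: sublevel_complement_def sublevel_def K_def)
  \<comment> \<open>In this form both claims become statements about Robin constants alone.\<close>
  have cap: "normalized_capacity f \<Omega> t = exp (ln t / real m - \<rho>)"
    if "0 < t" "robin_constant (K t) = ereal \<rho>" for t \<rho>
    using that by (simp add: normalized_capacity_def K_eq log_capacity_def powr_def exp_diff exp_minus field_simps flip: m_def)
  have "mono_on {0<..<1} (normalized_capacity f \<Omega>)"
  proof (rule mono_onI)
    fix s t :: real assume st: "s \<in> {0<..<1}" "t \<in> {0<..<1}" "s \<le> t"
    show "normalized_capacity f \<Omega> s \<le> normalized_capacity f \<Omega> t"
    proof (cases "s = t")
      case False
      then have st': "0 < s" "s < t" "t < 1"
        using st by auto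
      obtain \<rho> \<sigma> where \<rho>: "robin_constant (K s) = ereal \<rho>" and \<sigma>: "robin_constant (K t) = ereal \<sigma>"
        using robin_constant_K_real[of s] robin_constant_K_real[of t] st' by (metis order_less_trans)
      have "\<sigma> \<le> \<rho> + (ln t - ln s) / real m"
        using robin_constant_K_mono[OF st'] by (simp add: \<rho> \<sigma>)
      then have "ln s / real m - \<rho> \<le> ln t / real m - \<sigma>"
        by (simp add: diff_divide_distrib)
      then show ?thesis
        using st' by (simp add: cap[OF _ \<rho>] cap[OF _ \<sigma>])
    qed simp
  qed
  moreover obtain t\<^sub>1 where t\<^sub>1: "0 < t\<^sub>1" "t\<^sub>1 < 1"
    "\<And>t. 0 < t \<Longrightarrow> t < t\<^sub>1 \<Longrightarrow> ereal ((ln t - ln (cmod c)) / real m) \<le> robin_constant (K t)"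
    by (rule robin_constant_K_ge) blast
  have "normalized_capacity f \<Omega> t = cmod c powr (1 / real m)" if t: "t \<in> {0<..<t\<^sub>1}" for t
  proof -
    \<comment> \<open>The upper bound holds at every level, the lower bound only below the
      threshold.\<close>
    have "robin_constant (K t) = ereal ((ln t - ln (cmod c)) / real m)"
      using t t\<^sub>1 by (intro antisym robin_constant_K_le) auto
    then show ?thesis
      using t c_nonzero by (simp add: cap powr_def diff_divide_distrib)
  qed
  ultimately show ?thesis
    using t\<^sub>1(1,2) unfolding m_def c_def by (intro conjI bexI[of _ t\<^sub>1]) auto
qed

end
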